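(* Let $r=r(n)$ and $s=s(n)$ be sequences of positive integers with $s<r<n$, such that, as $n\to\infty$, $r\to\infty$, $s\to\infty$, $s=o(r)$ and $r^2=o(n)$. Let $p=p(n)\in[0,1]$ satisfy $$p\ \ge\ \frac{16\,s\,r^2\ln(n/r)}{n}.$$ Then $$\mathsf{P}\Bigl(\alpha\bigl(G_p(n,r,<s)\bigr)=\binom{n-s}{r-s}\Bigr)\to 1,\qquad n\to\infty.$$
   Context: $[n]=\{1,\dots,n\}$. The graph $G(n,r,<s)$ has vertex set $V(n,r)=\{x\subset[n]\colon |x|=r\}$, and two distinct vertices $x,y$ are joined by an edge if and only if $|x\cap y|<s$. For $p\in[0,1]$, the random graph $G_p(n,r,<s)$ is the random spanning subgraph of $G(n,r,<s)$ (same vertex set $V(n,r)$) in which each edge of $G(n,r,<s)$ is kept with probability $p$, independently of all other edges. For a graph $H$, $\alpha(H)$ denotes its independence number, i.e. the maximum cardinality of a set of vertices no two of which are joined by an edge. *)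

theory Defs
  imports "HOL-Probability.Probability" "HOL-Library.Landau_Symbols"
begin

text \<open>
  A finite simple graph is a pair of a vertex set and an edge set, the edges being
  two-element sets of vertices.
\<close>

type_synonym 'a sgraph = "'a set \<times> 'a set set"

abbreviation verts :: "'a sgraph \<Rightarrow> 'a set" where
  "verts H \<equiv> fst H"

abbreviation edges :: "'a sgraph \<Rightarrow> 'a set set" where
  "edges H \<equiv> snd H"

definition independent_set :: "'a sgraph \<Rightarrow> 'a set \<Rightarrow> bool" where
  "independent_set H A \<longleftrightarrow> A \<subseteq> verts H \<and> (\<forall>x\<in>A. \<forall>y\<in>A. {x, y} \<notin> edges H)"

definition independence_number :: "'a sgraph \<Rightarrow> nat" where
  "independence_number H = Max {card A | A. independent_set H A}"

definition subset_graph :: "nat \<Rightarrow> nat \<Rightarrow> nat \<Rightarrow> nat set sgraph" where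
  "subset_graph n r s =
     (let V = {x. x \<subseteq> {1..n} \<and> card x = r}
      in (V, {{x, y} | x y. x \<in> V \<and> y \<in> V \<and> x \<noteq> y \<and> card (x \<inter> y) < s}))"

text \<open>
  The family \<open>kept\<close> consists of independent Bernoulli variables indexed by the edges of
  \<open>H\<close>; the value \<open>False\<close> outside \<open>edges H\<close> is only the default required by \<^const>\<open>Pi_pmf\<close>.
  The definition is meaningful for a finite edge set and a probability \<open>p\<close> in the unit
  interval.
\<close>

definition random_spanning_subgraph :: "'a sgraph \<Rightarrow> real \<Rightarrow> 'a sgraph pmf" where
  "random_spanning_subgraph H p =
     map_pmf (\<lambda>kept. (verts H, {e \<in> edges H. kept e}))
       (Pi_pmf (edges H) False (\<lambda>_. bernoulli_pmf p))"

definition random_subset_graph :: "nat \<Rightarrow> nat \<Rightarrow> nat \<Rightarrow> real \<Rightarrow> nat set sgraph pmf" where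
  "random_subset_graph n r s p = random_spanning_subgraph (subset_graph n r s) p"

end

theory Submission
  imports Defs
begin

text \<open>
  Write \<open>N\<close> for the size of the star of an \<open>s\<close>-set and \<open>\<delta> = r\<^sup>2 / n\<close>. Stars stay independent, so
  it suffices to exclude independent sets \<open>A\<close> of size \<open>N + 1\<close> by a first moment bound, for
  which \<open>A\<close> must span many edges of the full graph.

  The key fact is a weak form of the Hilton--Milner--Frankl theorem: an \<open>s\<close>-intersecting family
  that is not contained in a star has at most \<open>4\<delta>N\<close> members. For such a family every star
  contributes at most \<open>\<delta>N\<close> members. In a shifted family all members outside the star of \<open>{1..s}\<close>
  meet some \<open>{1..s + 2j}\<close>, \<open>j \<ge> 1\<close>, in \<open>s + j\<close> elements, and there are at most \<open>3\<delta>N\<close> such sets.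

  If every star meets \<open>A\<close> in at most \<open>4\<delta>N\<close> sets, then all independent subsets of \<open>A\<close> are that
  small and Turan's bound gives about \<open>N / (8\<delta>)\<close> edges, twice what is needed against the
  \<open>exp (N s ln (n/r))\<close> choices of \<open>A\<close>. Otherwise some star meets \<open>A\<close> in more than \<open>4\<delta>N\<close> sets, and
  each of the \<open>k\<close> members of \<open>A\<close> outside it sends at least \<open>3\<delta>N\<close> edges into it, against only
  \<open>exp (O(n k))\<close> choices of \<open>A\<close>.
\<close>

section \<open>Stars\<close>

definition ksubsets :: "nat \<Rightarrow> nat \<Rightarrow> nat set set" where
  "ksubsets n r = {x. x \<subseteq> {1..n} \<and> card x = r}"

definition star :: "nat \<Rightarrow> nat \<Rightarrow> nat set \<Rightarrow> nat set set" where
  "star n r S = {x \<in> ksubsets n r. S \<subseteq> x}"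

definition intersecting :: "nat \<Rightarrow> nat set set \<Rightarrow> bool" where
  "intersecting s F \<longleftrightarrow> (\<forall>x\<in>F. \<forall>y\<in>F. s \<le> card (x \<inter> y))"

lemma finite_ksubsets [simp]: "finite (ksubsets n r)"
  unfolding ksubsets_def by (rule finite_subset[of _ "Pow {1..n}"]) auto

lemma card_ksubsets: "card (ksubsets n r) = n choose r"
  unfolding ksubsets_def using n_subsets[of "{1..n}" r] by simp

lemma ksubsets_finite: "x \<in> ksubsets n r \<Longrightarrow> finite x"
  unfolding ksubsets_def using finite_subset by blast

lemma star_subset: "star n r S \<subseteq> ksubsets n r"
  by (auto simp: star_def)

lemma finite_star [simp]: "finite (star n r S)"
  by (rule finite_subset[OF star_subset]) simp

lemma card_star:
  assumes "S \<subseteq> {1..n}" "card S \<le> r"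
  shows "card (star n r S) = (n - card S) choose (r - card S)"
proof -
  have fin: "finite S" using assms(1) finite_subset by blast
  have "bij_betw (\<lambda>x. x - S) (star n r S) {y. y \<subseteq> {1..n} - S \<and> card y = r - card S}"
  proof (rule bij_betw_byWitness[where f' = "\<lambda>y. y \<union> S"])
    show "\<forall>x\<in>star n r S. x - S \<union> S = x" by (auto simp: star_def)
    show "\<forall>y\<in>{y. y \<subseteq> {1..n} - S \<and> card y = r - card S}. y \<union> S - S = y" by auto
    show "(\<lambda>x. x - S) ` star n r S \<subseteq> {y. y \<subseteq> {1..n} - S \<and> card y = r - card S}"
      using fin by (auto simp: star_def ksubsets_def card_Diff_subset)
    have "card (y \<union> S) = r" if "y \<subseteq> {1..n} - S" "card y = r - card S" for y
    proof -
      have "finite y" using that(1) finite_subset by blast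
      then show ?thesis using that fin assms(2) by (subst card_Un_disjoint) auto
    qed
    then show "(\<lambda>y. y \<union> S) ` {y. y \<subseteq> {1..n} - S \<and> card y = r - card S} \<subseteq> star n r S"
      using assms(1) by (auto simp: star_def ksubsets_def)
  qed
  then have "card (star n r S) = card {y. y \<subseteq> {1..n} - S \<and> card y = r - card S}"
    by (rule bij_betw_same_card)
  also have "\<dots> = (n - card S) choose (r - card S)"
    using n_subsets[of "{1..n} - S" "r - card S"] assms(1) fin by (simp add: card_Diff_subset)
  finally show ?thesis .
qed

lemma card_star_le:
  assumes "card S \<le> r" "finite S"
  shows "card (star n r S) \<le> (n - card S) choose (r - card S)"
proof (cases "S \<subseteq> {1..n}")
  case True then show ?thesis using card_star assms by simp
next
  case False
  then have "star n r S = {}" by (auto simp: star_def ksubsets_def)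
  then show ?thesis by simp
qed

text \<open>Absorption gives the factor \<open>(r - t) / (n - t)\<close> for each passage from
  \<open>t\<close> to \<open>t + 1\<close>, and this is at most \<open>r / n\<close> because
  \<open>r \<le> n\<close>.\<close>

lemma binomial_descend_le:
  assumes "s + j \<le> r" "r \<le> n"
  shows "real ((n - (s + j)) choose (r - (s + j))) \<le> (real r / real n) ^ j * real ((n - s) choose (r - s))"
  using assms
proof (induction j)
  case 0 then show ?case by simp
next
  case (Suc j)
  define m k where "m = n - (s + Suc j)" and "k = r - (s + Suc j)"
  have mk: "n - (s + j) = Suc m" "r - (s + j) = Suc k" "k \<le> m"
    using Suc.prems by (auto simp: m_def k_def)
  have "Suc k * (Suc m choose Suc k) = Suc m * (m choose k)"
    using binomial_absorption[of k "Suc m"] by simp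
  then have "real (Suc m) * real (m choose k) = real (Suc k) * real (Suc m choose Suc k)"
    by (metis of_nat_mult)
  then have "real (m choose k) = real (Suc k) / real (Suc m) * real (Suc m choose Suc k)"
    by (simp add: field_simps del: binomial_Suc_Suc of_nat_Suc)
  also have "\<dots> \<le> real r / real n * real (Suc m choose Suc k)"
  proof (rule mult_right_mono)
    have "Suc k * n \<le> r * Suc m"
    proof -
      \<comment> \<open>With the common offset \<open>d\<close> the inequality reduces to
        \<open>Suc k * d \<le> d * Suc m\<close>, that is, to \<open>k \<le> m\<close>.\<close>
      obtain d where d: "r = Suc k + d" "n = Suc m + d" 
        using Suc.prems mk unfolding m_def k_def by (metis add.commute add_leD2 le_add_diff_inverse2 add_leD1 Suc_leD add_Suc_right le_trans)
      show ?thesis using mk(3) unfolding d by (simp add: algebra_simps)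
    qed
    then have "real (Suc k) * real n \<le> real r * real (Suc m)" by (metis of_nat_le_iff of_nat_mult)
    then show "real (Suc k) / real (Suc m) \<le> real r / real n"
      using Suc.prems by (simp add: divide_le_eq le_divide_eq field_simps)
  qed simp
  also have "\<dots> \<le> real r / real n * ((real r / real n) ^ j * real ((n - s) choose (r - s)))"
    using Suc.IH Suc.prems mk by (intro mult_left_mono) (auto simp del: binomial_Suc_Suc)
  finally show ?case by (simp add: m_def k_def mult.assoc)
qed

text \<open>Since \<open>x\<close> misses a point of \<open>S\<close>, a set \<open>y\<close>
  containing \<open>S\<close> can meet \<open>x\<close> in \<open>s\<close> points only by
  containing some \<open>e\<close> of \<open>x\<close> outside \<open>S\<close>. There are at most
  \<open>r\<close> choices of \<open>e\<close>, and each confines \<open>y\<close> to the star of an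
  \<open>(s + 1)\<close>-set, a fraction of at most \<open>r / n\<close> of the original
  star.\<close>

lemma card_star_inter_ge:
  assumes "finite S" "card S = s" "0 < s" "s < r" "r \<le> n" "x \<in> ksubsets n r" "\<not> S \<subseteq> x"
  shows "real (card {y \<in> star n r S. s \<le> card (x \<inter> y)})
           \<le> real r ^ 2 / real n * real ((n - s) choose (r - s))"
proof -
  have fx: "finite x" "card x = r" using assms by (auto simp: ksubsets_def intro: finite_subset)
  have "{y \<in> star n r S. s \<le> card (x \<inter> y)} \<subseteq> (\<Union>e\<in>x - S. star n r (insert e S))"
  proof
    fix y assume y: "y \<in> {y \<in> star n r S. s \<le> card (x \<inter> y)}"
    have "\<exists>e. e \<in> x \<inter> y - S"
    proof (rule ccontr)
      assume "\<nexists>e. e \<in> x \<inter> y - S"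
      then have "x \<inter> y \<subseteq> x \<inter> S" by auto
      then have "card (x \<inter> y) \<le> card (x \<inter> S)" using fx by (intro card_mono) auto
      also have "\<dots> < card S" using assms by (intro psubset_card_mono) auto
      finally show False using y assms by simp
    qed
    then show "y \<in> (\<Union>e\<in>x - S. star n r (insert e S))" using y by (auto simp: star_def)
  qed
  then have "card {y \<in> star n r S. s \<le> card (x \<inter> y)} \<le> card (\<Union>e\<in>x - S. star n r (insert e S))"
    using fx by (intro card_mono) auto
  also have "\<dots> \<le> (\<Sum>e\<in>x - S. card (star n r (insert e S)))"
    using fx by (intro card_UN_le) auto
  also have "\<dots> \<le> (\<Sum>e\<in>x - S. (n - (s + 1)) choose (r - (s + 1)))"
  proof (rule sum_mono)
    fix e assume "e \<in> x - S"
    then show "card (star n r (insert e S)) \<le> (n - (s + 1)) choose (r - (s + 1))"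
      using card_star_le[of "insert e S" r n] assms by simp
  qed
  also have "\<dots> \<le> r * ((n - (s + 1)) choose (r - (s + 1)))"
    using fx card_mono[of x "x - S"] by simp
  finally have "real (card {y \<in> star n r S. s \<le> card (x \<inter> y)})
      \<le> real r * real ((n - (s + 1)) choose (r - (s + 1)))"
    by (metis of_nat_le_iff of_nat_mult)
  also have "\<dots> \<le> real r * ((real r / real n) ^ 1 * real ((n - s) choose (r - s)))"
    using assms by (intro mult_left_mono binomial_descend_le) auto
  finally show ?thesis by (simp add: power2_eq_square)
qed

section \<open>Shifting and non-trivial intersecting families\<close>

text \<open>This is the compression of Erdos, Ko and Rado, replacing \<open>j\<close> by
  \<open>i\<close>. A set stays put when its replacement is already present, so moved sets land
  outside \<open>F\<close> and the map is injective on \<open>F\<close>.\<close>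

definition shift_set :: "nat \<Rightarrow> nat \<Rightarrow> nat set set \<Rightarrow> nat set \<Rightarrow> nat set" where
  "shift_set i j F x =
     (if j \<in> x \<and> i \<notin> x \<and> insert i (x - {j}) \<notin> F then insert i (x - {j}) else x)"

definition shift_family :: "nat \<Rightarrow> nat \<Rightarrow> nat set set \<Rightarrow> nat set set" where
  "shift_family i j F = shift_set i j F ` F"

definition shifted :: "nat \<Rightarrow> nat set set \<Rightarrow> bool" where
  "shifted n F \<longleftrightarrow> (\<forall>x\<in>F. \<forall>i j. 1 \<le> i \<and> i < j \<and> j \<le> n \<and> j \<in> x \<and> i \<notin> x \<longrightarrow> insert i (x - {j}) \<in> F)"

lemma insert_diff_cancel: "j \<in> x \<Longrightarrow> i \<notin> x \<Longrightarrow> j \<in> y \<Longrightarrow> i \<notin> y \<Longrightarrow> insert i (x - {j}) = insert i (y - {j}) \<Longrightarrow> x = y"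
  by (metis Diff_insert_absorb insert_Diff insert_Diff_single insert_ident Diff_iff)

lemma inj_on_shift_set: "inj_on (shift_set i j F) F"
proof (rule inj_onI)
  fix x y assume "x \<in> F" "y \<in> F" "shift_set i j F x = shift_set i j F y"
  then show "x = y"
    using insert_diff_cancel[of j x i y] unfolding shift_set_def by (simp split: if_splits)
qed

lemma card_shift_family: "card (shift_family i j F) = card F"
  unfolding shift_family_def by (rule card_image[OF inj_on_shift_set])

lemma card_swap: "finite x \<Longrightarrow> j \<in> x \<Longrightarrow> i \<notin> x \<Longrightarrow> card (insert i (x - {j})) = card x"
  using card.remove[of x j] by simp

lemma shift_family_ksubsets:
  assumes "F \<subseteq> ksubsets n r" "1 \<le> i" "i \<le> n"
  shows "shift_family i j F \<subseteq> ksubsets n r"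
proof
  fix y assume "y \<in> shift_family i j F"
  then obtain x where x: "x \<in> F" "y = shift_set i j F x" by (auto simp: shift_family_def)
  then have "x \<in> ksubsets n r" using assms by auto
  moreover from this have "finite x" by (rule ksubsets_finite)
  ultimately show "y \<in> ksubsets n r"
    using assms card_swap[of x j i] unfolding x(2) shift_set_def ksubsets_def by auto
qed

text \<open>Only a moved \<open>x\<close> against an unmoved \<open>y\<close> is delicate. If
  \<open>i\<close> lies in \<open>y\<close>, the possible loss of \<open>j\<close> is made up by the
  gain of \<open>i\<close>; if \<open>y\<close> contains neither, nothing changes. If
  \<open>y\<close> contains \<open>j\<close> but not \<open>i\<close>, it stayed put because its own
  replacement is in \<open>F\<close>, and moving \<open>y\<close> instead of \<open>x\<close> gives
  an intersection that is the same set.\<close>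

lemma intersecting_shift_family:
  assumes F: "intersecting s F" and fin: "\<And>x. x \<in> F \<Longrightarrow> finite x" and ij: "i \<noteq> j"
  shows "intersecting s (shift_family i j F)"
proof -
  let ?m = "\<lambda>x. insert i (x - {j})"
  let ?c = "\<lambda>x. j \<in> x \<and> i \<notin> x \<and> ?m x \<notin> F"
  have mixed: "s \<le> card (?m x \<inter> y)" if x: "x \<in> F" "?c x" and y: "y \<in> F" "\<not> ?c y" for x y
  proof -
    have fxy: "finite x" "finite y" "s \<le> card (x \<inter> y)"
      using F fin x y by (auto simp: intersecting_def)
    consider "i \<in> y" | "i \<notin> y" "j \<notin> y" | "i \<notin> y" "j \<in> y" "?m y \<in> F" using y by blast
    then show ?thesis
    proof cases
      case 1
      have "x \<inter> y \<subseteq> insert j (?m x \<inter> y - {i})" using x by auto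
      then have "card (x \<inter> y) \<le> card (insert j (?m x \<inter> y - {i}))"
        using fxy by (intro card_mono) auto
      also have "\<dots> \<le> Suc (card (?m x \<inter> y - {i}))"
        by (rule card_insert_le_m1) auto
      also have "\<dots> = card (?m x \<inter> y)"
        using 1 fxy by (subst card.remove[of "?m x \<inter> y" i]) auto
      finally show ?thesis using fxy by simp
    next
      case 2
      then have "?m x \<inter> y = x \<inter> y" by auto
      then show ?thesis using fxy by simp
    next
      case 3
      then have eq: "?m x \<inter> y = x \<inter> ?m y" using x by auto
      have "s \<le> card (x \<inter> ?m y)" using 3 F x unfolding intersecting_def by blast
      then show ?thesis unfolding eq .
    qed
  qed
  have both: "s \<le> card (?m x \<inter> ?m y)" if x: "x \<in> F" "?c x" and y: "y \<in> F" "?c y" for x y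
  proof -
    have "card (?m x \<inter> ?m y) = card (?m (x \<inter> y))" by (rule arg_cong[of _ _ card]) auto
    also have "\<dots> = card (x \<inter> y)" using x y fin by (intro card_swap) auto
    finally show ?thesis using F x y by (simp add: intersecting_def)
  qed
  have plain: "s \<le> card (x \<inter> y)" if "x \<in> F" "y \<in> F" for x y
    using F that by (simp add: intersecting_def)
  show ?thesis
    unfolding intersecting_def shift_family_def
  proof (intro ballI, elim imageE, simp only:)
    fix x y assume "x \<in> F" "y \<in> F"
    then show "s \<le> card (shift_set i j F x \<inter> shift_set i j F y)"
      using mixed[of x y] mixed[of y x] both[of x y] plain[of x y]
      unfolding shift_set_def by (auto simp: Int_commute)
  qed
qed

text \<open>The total of all elements of all members is the potential that makes repeated shifting
  terminate: every moved set trades \<open>j\<close> for the smaller \<open>i\<close>.\<close>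

lemma sum_shift_family_less:
  assumes "finite F" "\<And>x. x \<in> F \<Longrightarrow> finite x" "i < j" "x0 \<in> F" "j \<in> x0" "i \<notin> x0"
    "insert i (x0 - {j}) \<notin> F"
  shows "(\<Sum>x\<in>shift_family i j F. \<Sum>x) < (\<Sum>x\<in>F. \<Sum>x)"
proof -
  have less: "\<Sum>(insert i (x - {j})) < \<Sum>x" if "x \<in> F" "j \<in> x" "i \<notin> x" for x
  proof -
    have "finite x" using that assms by auto
    then have "\<Sum>x = j + \<Sum>(x - {j})" "\<Sum>(insert i (x - {j})) = i + \<Sum>(x - {j})"
      using that by (auto simp: sum.remove[of x j])
    then show ?thesis using assms by simp
  qed
  have "(\<Sum>x\<in>shift_family i j F. \<Sum>x) = (\<Sum>x\<in>F. \<Sum>(shift_set i j F x))"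
    unfolding shift_family_def by (simp add: sum.reindex[OF inj_on_shift_set])
  also have "\<dots> < (\<Sum>x\<in>F. \<Sum>x)"
  proof (rule sum_strict_mono_ex1)
    show "\<forall>x\<in>F. \<Sum>(shift_set i j F x) \<le> \<Sum>x"
      using less by (auto simp: shift_set_def intro: less_imp_le)
    show "\<exists>x\<in>F. \<Sum>(shift_set i j F x) < \<Sum>x"
      using less[of x0] assms by (intro bexI[of _ x0]) (auto simp: shift_set_def)
  qed (use assms in auto)
  finally show ?thesis .
qed

text \<open>
  If every initial segment failed the bound, replacing one by one all elements of \<open>x\<close> from
  the \<open>s\<close>-th on by smaller elements outside \<open>x\<close> would stay in \<open>F\<close> and end in a set meeting
  \<open>x\<close> in \<open>s - 1\<close> elements.
\<close>

lemma shifted_intersecting_prefix: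
  assumes F: "F \<subseteq> ksubsets n r" "intersecting s F" "shifted n F" and s: "0 < s" "s \<le> r"
    and x: "x \<in> F"
  shows "\<exists>j. s + j \<le> r \<and> s + j \<le> card (x \<inter> {1..s + 2 * j})"
proof (rule ccontr)
  assume neg: "\<not> ?thesis"
  have "x \<in> ksubsets n r" using F x by blast
  then have x1: "finite x" "card x = r" "x \<subseteq> {1..n}"
    by (auto simp: ksubsets_finite) (auto simp: ksubsets_def)
  define xs where "xs = sorted_list_of_set x"
  have xs: "sorted xs" "distinct xs" "set xs = x" "length xs = r" "sorted_wrt (<) xs"
    using x1 by (auto simp: xs_def)
  have claim: "\<exists>C. finite C \<and> C \<inter> x = {} \<and> card C = j \<and>
      set (take (s - 1) xs) \<union> set (drop (s - 1 + j) xs) \<union> C \<in> F" if "s - 1 + j \<le> r" for j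
    using that
  proof (induction j)
    case 0
    have "set (take (s - 1) xs) \<union> set (drop (s - 1) xs) = x"
      by (metis append_take_drop_id set_append xs(3))
    then show ?case using x by (intro exI[of _ "{}"]) simp
  next
    case (Suc j)
    then obtain C where C: "finite C" "C \<inter> x = {}" "card C = j"
      "set (take (s - 1) xs) \<union> set (drop (s - 1 + j) xs) \<union> C \<in> F" by auto
    \<comment> \<open>List indices start at 0, so \<open>a\<close> is the \<open>(s + j)\<close>-th
      smallest element of \<open>x\<close>, the next one to be replaced. \<open>C\<close> holds the
      \<open>j\<close> replacements made so far.\<close>
    define a where "a = xs ! (s - 1 + j)"
    let ?y = "set (take (s - 1) xs) \<union> set (drop (s - 1 + j) xs) \<union> C"
    have len: "s - 1 + j < length xs" using Suc.prems xs by simp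
    have dr: "drop (s - 1 + j) xs = a # drop (s - 1 + Suc j) xs"
      using len by (simp add: a_def Cons_nth_drop_Suc)
    have ax: "a \<in> x" using len xs unfolding a_def by auto
    have an: "1 \<le> a" "a \<le> n" using ax x1 by auto
    have le: "y \<le> a" if "y \<in> set (take (s + j) xs)" for y
    proof -
      from that obtain k where "k < s + j" "k < length xs" "y = xs ! k"
        by (auto simp: in_set_conv_nth)
      then show ?thesis using xs(1) len s unfolding a_def by (auto intro!: sorted_nth_mono)
    qed
    have prefix: "set (take (s + j) xs) \<subseteq> x \<inter> {1..a}"
      using le x1 xs by (auto dest: in_set_takeD)
    have ge: "x \<inter> {1..a} \<subseteq> set (take (s + j) xs)"
    proof
      fix y assume y: "y \<in> x \<inter> {1..a}"
      then obtain k where k: "k < length xs" "y = xs ! k" using xs by (auto simp: in_set_conv_nth)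
      have "k \<le> s - 1 + j"
      proof (rule ccontr)
        assume "\<not> k \<le> s - 1 + j"
        then have "a < y" using k xs(5) unfolding a_def by (auto simp: sorted_wrt_iff_nth_less)
        then show False using y by auto
      qed
      then show "y \<in> set (take (s + j) xs)"
        using k s by (auto simp: in_set_conv_nth intro!: exI[of _ k])
    qed
    have cardp: "card (x \<inter> {1..a}) = s + j"
      using prefix ge len xs(2) s
      by (subst subset_antisym[OF ge prefix]) (simp add: distinct_card)
    \<comment> \<open>As \<open>{1..a}\<close> contains \<open>s + j\<close> elements of
      \<open>x\<close>, the negated claim forces \<open>a > s + 2 * j\<close>. Hence more than
      \<open>j\<close> elements of \<open>{1..a}\<close> avoid \<open>x\<close>, and one of them is
      not yet in \<open>C\<close>.\<close>
    have big: "s + 2 * j < a"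
    proof (rule ccontr)
      assume "\<not> s + 2 * j < a"
      then have "card (x \<inter> {1..a}) \<le> card (x \<inter> {1..s + 2 * j})" by (intro card_mono) auto
      then show False using neg cardp Suc.prems s by auto
    qed
    have "card ({1..a} - x) = a - (s + j)"
      using cardp card_Diff_subset_Int[of "{1..a}" x] by (simp add: Int_commute)
    then have "card C < card ({1..a} - x)" using big C by simp
    then have "\<not> {1..a} - x \<subseteq> C" using C(1) card_mono by (metis not_le)
    then obtain c where c: "c \<in> {1..a}" "c \<notin> x" "c \<notin> C" by blast
    have "c \<noteq> a" using c ax by auto
    then have ca: "c < a" using c by auto
    have cy: "c \<notin> ?y" using c xs by (auto dest: in_set_takeD in_set_dropD)
    have ay: "a \<in> ?y" using dr by simp
    have "insert c (?y - {a}) \<in> F"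
      using F(3) C(4) ca cy ay an c unfolding shifted_def by auto
    moreover have "insert c (?y - {a}) =
        set (take (s - 1) xs) \<union> set (drop (s - 1 + Suc j) xs) \<union> insert c C"
    proof -
      have "a \<notin> C" using ax C by auto
      moreover have "distinct (take (s - 1 + j) xs @ a # drop (s - 1 + Suc j) xs)"
        using xs(2) dr by (metis append_take_drop_id)
      then have "a \<notin> set (take (s - 1 + j) xs)" "a \<notin> set (drop (s - 1 + Suc j) xs)" by auto
      moreover have "set (take (s - 1) xs) \<subseteq> set (take (s - 1 + j) xs)"
        by (rule set_take_subset_set_take) simp
      ultimately show ?thesis using dr by auto
    qed
    moreover have "card (insert c C) = Suc j" using C c by simp
    moreover have "insert c C \<inter> x = {}" using C c by auto
    ultimately show ?case using C(1) by (intro exI[of _ "insert c C"]) simp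
  qed
  obtain C where C: "C \<inter> x = {}" "set (take (s - 1) xs) \<union> C \<in> F"
    using claim[of "r - (s - 1)"] s xs by auto
  have "x \<inter> (set (take (s - 1) xs) \<union> C) \<subseteq> set (take (s - 1) xs)" using C by auto
  then have "card (x \<inter> (set (take (s - 1) xs) \<union> C)) \<le> card (set (take (s - 1) xs))"
    by (intro card_mono) auto
  also have "\<dots> \<le> s - 1" by (metis card_length length_take min.cobounded2 order_trans)
  finally have "card (x \<inter> (set (take (s - 1) xs) \<union> C)) < s" using s by simp
  moreover have "s \<le> card (x \<inter> (set (take (s - 1) xs) \<union> C))"
    using F(2) x C(2) unfolding intersecting_def by blast
  ultimately show False by simp
qed

section \<open>Size of non-trivial intersecting families\<close>

lemma sum_power_le:
  fixes q :: real
  assumes "0 \<le> q" "q \<le> 1/8"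
  shows "(\<Sum>j=1..m. q ^ j) \<le> 8/7 * q"
proof -
  have "(\<Sum>j=1..m. q ^ j) = q * (\<Sum>j<m. q ^ j)"
    by (simp add: sum_distrib_left sum.atLeast1_atMost_eq)
  also have "(\<Sum>j<m. q ^ j) = (1 - q ^ m) / (1 - q)"
    using assms by (simp add: sum_gp_strict)
  also have "q * ((1 - q ^ m) / (1 - q)) \<le> q * (8/7)"
    using assms by (intro mult_left_mono) (simp_all add: divide_le_eq,
      smt (verit) zero_le_power)
  finally show ?thesis by simp
qed

text \<open>The index \<open>j = 0\<close> would put \<open>{1..s}\<close> inside \<open>x\<close>,
  so \<open>j \<ge> 1\<close>. Then \<open>x\<close> lies in the star of an
  \<open>(s + j)\<close>-subset of \<open>{1..s + 2 * j}\<close>. There are at most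
  \<open>(2 * r) ^ j\<close> such subsets, and each star is smaller than that of an
  \<open>s\<close>-set by the factor \<open>(r / n) ^ j\<close>. The sum over \<open>j\<close> is
  dominated by a geometric series of ratio \<open>2 * r ^ 2 / n\<close>.\<close>

lemma card_prefix_heavy:
  assumes s: "0 < s" "s < r" and n: "16 * r ^ 2 \<le> n"
  shows "real (card {x \<in> ksubsets n r. \<not> {1..s} \<subseteq> x \<and>
             (\<exists>j. s + j \<le> r \<and> s + j \<le> card (x \<inter> {1..s + 2 * j}))})
           \<le> 3 * (real r ^ 2 / real n) * real ((n - s) choose (r - s))"
    (is "real (card ?A) \<le> _")
proof -
  define N where "N = real ((n - s) choose (r - s))"
  let ?Q = "\<lambda>j. {T. T \<subseteq> {1..s + 2 * j} \<and> card T = s + j}"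
  have "r \<le> r ^ 2" by (simp add: power2_eq_square)
  then have rn: "r \<le> n" using n by simp
  have finQ: "finite (?Q j)" for j by (rule finite_subset[of _ "Pow {1..s + 2 * j}"]) auto
  have "?A \<subseteq> (\<Union>j\<in>{1..r - s}. \<Union>T\<in>?Q j. star n r T)"
  proof
    fix x assume x: "x \<in> ?A"
    then obtain j where j: "s + j \<le> r" "s + j \<le> card (x \<inter> {1..s + 2 * j})" by auto
    obtain T where T: "T \<subseteq> x \<inter> {1..s + 2 * j}" "card T = s + j"
      using obtain_subset_with_card_n[OF j(2)] by metis
    have "j \<noteq> 0"
    proof
      assume "j = 0"
      then have "T = {1..s}" using T by (intro card_subset_eq) auto
      then show False using T x by auto
    qed
    then have "j \<in> {1..r - s}" using j by auto
    moreover have "x \<in> star n r T" "T \<in> ?Q j" using T x by (auto simp: star_def)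
    ultimately show "x \<in> (\<Union>j\<in>{1..r - s}. \<Union>T\<in>?Q j. star n r T)" by blast
  qed
  then have "card ?A \<le> card (\<Union>j\<in>{1..r - s}. \<Union>T\<in>?Q j. star n r T)"
    using finQ by (intro card_mono) auto
  also have "\<dots> \<le> (\<Sum>j=1..r - s. card (\<Union>T\<in>?Q j. star n r T))"
    by (intro card_UN_le) auto
  also have "\<dots> \<le> (\<Sum>j=1..r - s. \<Sum>T\<in>?Q j. card (star n r T))"
    by (intro sum_mono card_UN_le finQ)
  finally have "real (card ?A) \<le> (\<Sum>j=1..r - s. real (\<Sum>T\<in>?Q j. card (star n r T)))"
    unfolding of_nat_sum[symmetric] by (simp only: of_nat_le_iff)
  also have "\<dots> \<le> (\<Sum>j=1..r - s. (2 * (real r ^ 2 / real n)) ^ j * N)"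
  proof (rule sum_mono)
    fix j assume j: "j \<in> {1..r - s}"
    have "(\<Sum>T\<in>?Q j. card (star n r T)) \<le> (\<Sum>T\<in>?Q j. (n - (s + j)) choose (r - (s + j)))"
    proof (rule sum_mono)
      fix T assume "T \<in> ?Q j"
      moreover then have "finite T" using finite_subset by blast
      ultimately show "card (star n r T) \<le> (n - (s + j)) choose (r - (s + j))"
        using card_star_le[of T r n] j by auto
    qed
    also have "\<dots> = ((s + 2 * j) choose (s + j)) * ((n - (s + j)) choose (r - (s + j)))"
      using n_subsets[of "{1..s + 2 * j}" "s + j"] by simp
    also have "(s + 2 * j) choose (s + j) = (s + 2 * j) choose j"
      by (subst binomial_symmetric) auto
    also have "(s + 2 * j) choose j \<le> (s + 2 * j) ^ j" by (rule binomial_le_pow) simp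
    also have "(s + 2 * j) ^ j \<le> (2 * r) ^ j" using j by (intro power_mono) auto
    finally have "real (\<Sum>T\<in>?Q j. card (star n r T))
        \<le> real ((2 * r) ^ j * ((n - (s + j)) choose (r - (s + j))))"
      by (simp only: of_nat_le_iff mult_le_mono1)
    also have "\<dots> = (2 * real r) ^ j * real ((n - (s + j)) choose (r - (s + j)))" by simp
    also have "\<dots> \<le> (2 * real r) ^ j * ((real r / real n) ^ j * N)"
      unfolding N_def using j rn s by (intro mult_left_mono binomial_descend_le) auto
    also have "\<dots> = (2 * (real r ^ 2 / real n)) ^ j * N"
      by (simp add: power_mult_distrib power_divide power2_eq_square)
    finally show "real (\<Sum>T\<in>?Q j. card (star n r T)) \<le> (2 * (real r ^ 2 / real n)) ^ j * N" .
  qed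
  also have "\<dots> = (\<Sum>j=1..r - s. (2 * (real r ^ 2 / real n)) ^ j) * N"
    by (simp add: sum_distrib_right)
  \<comment> \<open>The bound \<open>16 * r ^ 2 \<le> n\<close> makes the ratio at most 1/8, and 8/7
    is \<open>1 / (1 - 1/8)\<close>. The resulting 16/7 is then rounded up to 3.\<close>
  also have "\<dots> \<le> 8/7 * (2 * (real r ^ 2 / real n)) * N"
  proof (intro mult_right_mono sum_power_le)
    have "16 * real r ^ 2 \<le> real n" using of_nat_mono[OF n, where 'a = real] by simp
    then show "2 * (real r ^ 2 / real n) \<le> 1/8"
      by (cases "n = 0") (auto simp: divide_le_eq)
  qed (auto simp: N_def)
  also have "\<dots> \<le> 3 * (real r ^ 2 / real n) * N"
  proof (rule mult_right_mono)
    have "0 \<le> real r ^ 2 / real n" by simp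
    then show "8/7 * (2 * (real r ^ 2 / real n)) \<le> 3 * (real r ^ 2 / real n)" by linarith
  qed (simp add: N_def)
  finally show ?thesis unfolding N_def .
qed

text \<open>Some member lies outside the star, and all members inside must meet it in at least
  \<open>s\<close> points, so \<open>card_star_inter_ge\<close> applies.\<close>

lemma card_intersecting_star_le:
  assumes F: "F \<subseteq> ksubsets n r" "intersecting s F" and s: "0 < s" "s < r" "r \<le> n"
    and S: "finite S" "card S = s" "\<not> F \<subseteq> star n r S"
  shows "real (card (F \<inter> star n r S)) \<le> real r ^ 2 / real n * real ((n - s) choose (r - s))"
proof -
  obtain x where x: "x \<in> F" "x \<notin> star n r S" using S by auto
  then have "x \<in> ksubsets n r" "\<not> S \<subseteq> x" using F by (auto simp: star_def)
  note * = card_star_inter_ge[OF S(1,2) s this]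
  have "card (F \<inter> star n r S) \<le> card {y \<in> star n r S. s \<le> card (x \<inter> y)}"
    using F x by (intro card_mono) (auto simp: intersecting_def)
  then show ?thesis using * by simp
qed

text \<open>
  A single shift can only merge the stars of two \<open>s\<close>-sets, so it cannot turn a family without
  a large star into a large star. This keeps non-triviality under control while shifting.
\<close>

lemma intersecting_star_or_small:
  assumes "F \<subseteq> ksubsets n r" "intersecting s F" and s: "0 < s" "s < r" and n: "16 * r ^ 2 \<le> n"
  shows "(\<exists>S. S \<subseteq> {1..n} \<and> card S = s \<and> F \<subseteq> star n r S) \<or>
     real (card F) \<le> 4 * (real r ^ 2 / real n) * real ((n - s) choose (r - s))"
  using assms(1,2)
proof (induction "\<Sum>x\<in>F. \<Sum>x" arbitrary: F rule: less_induct)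
  case less
  define D where "D = real r ^ 2 / real n * real ((n - s) choose (r - s))"
  have D0: "0 \<le> D" unfolding D_def by simp
  have "r \<le> r ^ 2" by (simp add: power2_eq_square)
  then have rn: "r \<le> n" using n by simp
  have fF: "finite F" using less.prems(1) by (rule finite_subset) simp
  have fx: "finite x" if "x \<in> F" for x
    using subsetD[OF less.prems(1) that] by (rule ksubsets_finite)
  show ?case
  proof (cases "\<exists>S. S \<subseteq> {1..n} \<and> card S = s \<and> F \<subseteq> star n r S")
    case True then show ?thesis by blast
  next
    case nontriv: False
    have deg: "real (card (F \<inter> star n r S)) \<le> D" if "S \<subseteq> {1..n}" "card S = s" for S
      unfolding D_def using less.prems s rn that nontriv finite_subset
      by (intro card_intersecting_star_le) auto
    have "real (card F) \<le> 4 * D"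
    proof (cases "shifted n F")
      case True
      let ?A = "{x \<in> ksubsets n r. \<not> {1..s} \<subseteq> x \<and>
             (\<exists>j. s + j \<le> r \<and> s + j \<le> card (x \<inter> {1..s + 2 * j}))}"
      \<comment> \<open>The constant 4 is 1 + 3: members in the star of \<open>{1..s}\<close> number
        at most \<open>D\<close>, the others at most \<open>3 * D\<close>.\<close>
      have "F \<subseteq> (F \<inter> star n r {1..s}) \<union> ?A"
      proof
        fix x assume x: "x \<in> F"
        then have "\<exists>j. s + j \<le> r \<and> s + j \<le> card (x \<inter> {1..s + 2 * j})"
          using less.prems True s by (intro shifted_intersecting_prefix[of F n r s x]) auto
        then show "x \<in> (F \<inter> star n r {1..s}) \<union> ?A" using x less.prems by (auto simp: star_def)
      qed
      then have "card F \<le> card ((F \<inter> star n r {1..s}) \<union> ?A)"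
        using fF by (intro card_mono) auto
      also have "\<dots> \<le> card (F \<inter> star n r {1..s}) + card ?A" by (rule card_Un_le)
      finally have "real (card F) \<le> real (card (F \<inter> star n r {1..s})) + real (card ?A)"
        by (simp only: of_nat_le_iff of_nat_add[symmetric])
      moreover have "real (card (F \<inter> star n r {1..s})) \<le> D" using s rn by (intro deg) auto
      moreover have "real (card ?A) \<le> 3 * D"
        using card_prefix_heavy[OF s n] unfolding D_def by (simp add: mult.assoc)
      ultimately show ?thesis by linarith
    next
      case False
      then obtain x0 i j where ij: "x0 \<in> F" "1 \<le> i" "i < j" "j \<le> n" "j \<in> x0" "i \<notin> x0"
        "insert i (x0 - {j}) \<notin> F" unfolding shifted_def by blast
      let ?G = "shift_family i j F"
      have "(\<Sum>x\<in>?G. \<Sum>x) < (\<Sum>x\<in>F. \<Sum>x)"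
        using fF fx ij by (intro sum_shift_family_less[of F i j x0]) auto
      moreover have "?G \<subseteq> ksubsets n r" using less.prems ij by (intro shift_family_ksubsets) auto
      moreover have "intersecting s ?G"
        using less.prems fx ij by (intro intersecting_shift_family) auto
      ultimately consider "real (card ?G) \<le> 4 * D"
        | T where "T \<subseteq> {1..n}" "card T = s" "?G \<subseteq> star n r T"
        using less.hyps[of ?G] unfolding D_def by (auto simp: mult.assoc)
      then show ?thesis
      proof cases
        case 1 then show ?thesis by (simp add: card_shift_family)
      next
        case 2
        \<comment> \<open>\<open>T'\<close> is \<open>T\<close> with the shift undone. A member that
          was moved contained \<open>T'\<close> before the move, one that stayed put contains
          \<open>T\<close>, so two stars cover \<open>F\<close>, and each meets it in at most
          \<open>D\<close> sets.\<close>
        define T' where "T' = (if i \<in> T \<and> j \<notin> T then insert j (T - {i}) else T)"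
        have fT: "finite T" using 2 finite_subset by blast
        have T': "T' \<subseteq> {1..n}" "card T' = s"
          using 2 ij fT card_swap[of T i j] unfolding T'_def by auto
        have "F \<subseteq> (F \<inter> star n r T) \<union> (F \<inter> star n r T')"
        proof
          fix x assume x: "x \<in> F"
          then have "shift_set i j F x \<in> star n r T" using 2 unfolding shift_family_def by auto
          then have "T \<subseteq> shift_set i j F x" by (simp add: star_def)
          then have "T \<subseteq> x \<or> T' \<subseteq> x"
            unfolding shift_set_def T'_def by (auto split: if_splits)
          then show "x \<in> (F \<inter> star n r T) \<union> (F \<inter> star n r T')"
            using x less.prems by (auto simp: star_def)
        qed
        then have "card F \<le> card ((F \<inter> star n r T) \<union> (F \<inter> star n r T'))"
          using fF by (intro card_mono) auto
        also have "\<dots> \<le> card (F \<inter> star n r T) + card (F \<inter> star n r T')" by (rule card_Un_le)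
        finally have "real (card F) \<le> real (card (F \<inter> star n r T)) + real (card (F \<inter> star n r T'))"
          by (simp only: of_nat_le_iff of_nat_add[symmetric])
        then show ?thesis using deg[of T] deg[of T'] T' 2 D0 by linarith
      qed
    qed
    then show ?thesis unfolding D_def by (simp add: mult.assoc)
  qed
qed

section \<open>Edges and independent sets\<close>

text \<open>A form of Turan's theorem, by peeling off a maximum independent subset \<open>I\<close>
  of \<open>A\<close>. By maximality every vertex of \<open>A - I\<close> sends an edge into
  \<open>I\<close>; these edges are not spanned by \<open>A - I\<close>, where induction takes
  over.\<close>

lemma card_edges_ge_independence_bound:
  fixes E :: "'a set set" and K :: real
  assumes E: "\<And>e. e \<in> E \<Longrightarrow> card e = 2" and K: "0 < K" and A: "finite A"
    and indep: "\<And>B. B \<subseteq> A \<Longrightarrow> (\<And>e. e \<in> E \<Longrightarrow> \<not> e \<subseteq> B) \<Longrightarrow> real (card B) \<le> K"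
  shows "real (card A) * (real (card A) - K) / (2 * K) \<le> real (card {e \<in> E. e \<subseteq> A})"
  using A indep
proof (induction "card A" arbitrary: A rule: less_induct)
  case less
  show ?case
  proof (cases "A = {}")
    case True then show ?thesis by simp
  next
    case False
    define P where "P = (\<lambda>B. B \<subseteq> A \<and> (\<forall>e\<in>E. \<not> e \<subseteq> B))"
    have "P {}" using E[of "{}"] by (auto simp: P_def)
    moreover have "\<forall>B. P B \<longrightarrow> card B < Suc (card A)"
      using less.prems(1) by (auto simp: P_def less_Suc_eq_le card_mono)
    ultimately obtain I where I: "P I" and max: "\<And>B. P B \<Longrightarrow> card B \<le> card I"
      using ex_has_greatest_nat[of P "{}" card "Suc (card A)"] by blast
    have IA: "I \<subseteq> A" and fI: "finite I"
      using I less.prems(1) finite_subset by (auto simp: P_def)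
    have kK: "real (card I) \<le> K" using less.prems(2)[of I] I by (auto simp: P_def)
    obtain a where "a \<in> A" using False by auto
    have "\<not> e \<subseteq> {a}" if "e \<in> E" for e
      using card_mono[of "{a}" e] E[OF that] by auto
    then have "P {a}" using \<open>a \<in> A\<close> by (auto simp: P_def)
    then have k1: "1 \<le> card I" using max by fastforce
    have "\<exists>e\<in>E. v \<in> e \<and> e \<subseteq> insert v I \<and> \<not> e \<subseteq> A - I" if v: "v \<in> A - I" for v
    proof -
      have "\<not> P (insert v I)" using max[of "insert v I"] v fI by auto
      then obtain e where e: "e \<in> E" "e \<subseteq> insert v I" using v IA by (auto simp: P_def)
      have "v \<in> e" using e I by (auto simp: P_def)
      moreover have "\<not> e \<subseteq> A - I"
      proof
        assume "e \<subseteq> A - I"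
        then have "e \<subseteq> {v}" using e by auto
        then have "card e \<le> 1" using card_mono[of "{v}" e] by simp
        then show False using E e(1) by fastforce
      qed
      ultimately show ?thesis using e by auto
    qed
    \<comment> \<open>\<open>v\<close> is the only vertex of \<open>g v\<close> outside
      \<open>I\<close>, which makes \<open>g\<close> injective. The last condition keeps its edges
      apart from those counted by the induction hypothesis.\<close>
    then obtain g where g: "\<And>v. v \<in> A - I \<Longrightarrow>
        g v \<in> E \<and> v \<in> g v \<and> g v \<subseteq> insert v I \<and> \<not> g v \<subseteq> A - I"
      by metis
    have inj: "inj_on g (A - I)"
    proof (rule inj_onI)
      fix v w assume "v \<in> A - I" "w \<in> A - I" "g v = g w"
      then show "v = w" using g[of v] g[of w] by auto
    qed
    have fE: "finite {e \<in> E. e \<subseteq> A}"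
      by (rule finite_subset[of _ "Pow A"]) (use less.prems(1) in auto)
    have "g ` (A - I) \<union> {e \<in> E. e \<subseteq> A - I} \<subseteq> {e \<in> E. e \<subseteq> A}" using g IA by blast
    then have "card (g ` (A - I) \<union> {e \<in> E. e \<subseteq> A - I}) \<le> card {e \<in> E. e \<subseteq> A}"
      using fE by (intro card_mono)
    moreover have "card (g ` (A - I) \<union> {e \<in> E. e \<subseteq> A - I})
        = card (A - I) + card {e \<in> E. e \<subseteq> A - I}"
      using g less.prems(1) finite_subset[OF _ fE, of "{e \<in> E. e \<subseteq> A - I}"]
      by (subst card_Un_disjoint) (auto simp: card_image[OF inj])
    ultimately have main: "real (card (A - I)) + real (card {e \<in> E. e \<subseteq> A - I})
        \<le> real (card {e \<in> E. e \<subseteq> A})"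
      by linarith
    define m k where "m = real (card A)" and "k = real (card I)"
    have km: "k \<le> m" unfolding m_def k_def using IA less.prems(1) by (simp add: card_mono)
    have cd: "real (card (A - I)) = m - k"
      unfolding m_def k_def using IA fI less.prems(1)
      by (simp add: card_Diff_subset card_mono of_nat_diff)
    have "card (A - I) < card A"
      using cd k1 unfolding m_def k_def by linarith
    then have "(m - k) * (m - k - K) / (2 * K) \<le> real (card {e \<in> E. e \<subseteq> A - I})"
      unfolding cd[symmetric]
      by (rule less.hyps) (use less.prems in \<open>auto simp: subset_eq\<close>)
    moreover have "m * (m - K) / (2 * K) \<le> (m - k) + (m - k) * (m - k - K) / (2 * K)"
    proof -
      \<comment> \<open>This product is exactly the difference of the two sides after multiplication
        by \<open>2 * K\<close>.\<close>
      have "0 \<le> (K - k) * (2 * m - k)" using kK km k_def by (intro mult_nonneg_nonneg) auto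
      then have "m * (m - K) \<le> (m - k) * (2 * K) + (m - k) * (m - k - K)"
        by (simp add: algebra_simps)
      then have "m * (m - K) / (2 * K) \<le> ((m - k) * (2 * K) + (m - k) * (m - k - K)) / (2 * K)"
        using K by (intro divide_right_mono) auto
      also have "\<dots> = (m - k) + (m - k) * (m - k - K) / (2 * K)"
        using K by (simp add: add_divide_distrib)
      finally show ?thesis .
    qed
    ultimately show ?thesis using main unfolding cd m_def[symmetric] by linarith
  qed
qed

section \<open>First moment bound for the independence number\<close>

text \<open>Independence of \<open>A\<close> forces every edge inside \<open>A\<close> to be
  dropped. These are independent events of probability \<open>1 - p \<le> exp (- p)\<close>.\<close>

lemma prob_independent_set_le:
  fixes H :: "'a sgraph"
  assumes fin: "finite (edges H)" and p: "0 \<le> p" "p \<le> 1"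
    and E: "\<And>e. e \<in> edges H \<Longrightarrow> \<exists>x y. e = {x, y}"
  shows "measure_pmf.prob (random_spanning_subgraph H p) {H'. independent_set H' A}
           \<le> exp (- p * real (card {e \<in> edges H. e \<subseteq> A}))"
proof -
  let ?EA = "{e \<in> edges H. e \<subseteq> A}"
  \<comment> \<open>Leaving the edges not inside \<open>A\<close> unconstrained turns the event into
    a product set, whose measure factorises.\<close>
  define B :: "'a set \<Rightarrow> bool set" where "B = (\<lambda>e. if e \<subseteq> A then {False} else UNIV)"
  have "measure_pmf.prob (random_spanning_subgraph H p) {H'. independent_set H' A}
      = measure_pmf.prob (Pi_pmf (edges H) False (\<lambda>_. bernoulli_pmf p))
          {kept. independent_set (verts H, {e \<in> edges H. kept e}) A}"
    unfolding random_spanning_subgraph_def by (simp add: vimage_def)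
  also have "\<dots> \<le> measure_pmf.prob (Pi_pmf (edges H) False (\<lambda>_. bernoulli_pmf p)) (Pi (edges H) B)"
  proof (rule measure_pmf.finite_measure_mono)
    show "{kept. independent_set (verts H, {e \<in> edges H. kept e}) A} \<subseteq> Pi (edges H) B"
    proof
      fix kept assume kept: "kept \<in> {kept. independent_set (verts H, {e \<in> edges H. kept e}) A}"
      have "\<not> kept e" if "e \<in> edges H" "e \<subseteq> A" for e
        using kept that E[OF that(1)] by (auto simp: independent_set_def)
      then show "kept \<in> Pi (edges H) B" by (auto simp: B_def)
    qed
  qed simp
  also have "\<dots> = (\<Prod>e\<in>edges H. measure_pmf.prob (bernoulli_pmf p) (B e))"
    by (rule measure_Pi_pmf_Pi[OF fin])
  also have "\<dots> = (\<Prod>e\<in>edges H. if e \<in> ?EA then 1 - p else 1)"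
    using p by (intro prod.cong refl) (auto simp: B_def measure_pmf_single)
  also have "\<dots> = (1 - p) ^ card ?EA"
    using fin by (simp add: prod.If_cases Int_def)
  also have "\<dots> \<le> exp (- p) ^ card ?EA"
    using p exp_ge_add_one_self[of "- p"] by (intro power_mono) auto
  also have "\<dots> = exp (- p * real (card ?EA))"
    by (simp add: exp_of_nat_mult[symmetric] mult.commute)
  finally show ?thesis .
qed

lemma set_pmf_random_spanning_subgraph:
  "H' \<in> set_pmf (random_spanning_subgraph H p) \<Longrightarrow> verts H' = verts H \<and> edges H' \<subseteq> edges H"
  unfolding random_spanning_subgraph_def by auto

text \<open>Independence passes to subsets, so a larger independent set would contain one of size
  exactly \<open>Suc N\<close>. Excluding this single size is enough.\<close>

lemma independence_number_eqI:
  assumes fin: "finite (verts H)" and A: "independent_set H A" "card A = N"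
    and no: "\<And>B. independent_set H B \<Longrightarrow> card B \<noteq> Suc N"
  shows "independence_number H = N"
  unfolding independence_number_def
proof (rule Max_eqI)
  have "{card A |A. independent_set H A} \<subseteq> {..card (verts H)}"
    using card_mono[OF fin] by (auto simp: independent_set_def)
  then show "finite {card A |A. independent_set H A}" by (rule finite_subset) simp
  show "N \<in> {card A |A. independent_set H A}" using A by auto
  fix m assume "m \<in> {card A |A. independent_set H A}"
  then obtain B where B: "independent_set H B" "m = card B" by auto
  show "m \<le> N"
  proof (rule ccontr)
    assume "\<not> m \<le> N"
    then have "Suc N \<le> card B" using B by simp
    then obtain C where C: "C \<subseteq> B" "card C = Suc N" by (rule obtain_subset_with_card_n)
    then have "independent_set H C" using B(1) unfolding independent_set_def by blast
    then show False using no C by blast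
  qed
qed

text \<open>Deleting edges keeps \<open>A0\<close> independent, so the independence number can
  differ from \<open>N\<close> only if some set of size \<open>Suc N\<close> becomes independent.
  The union bound runs over these sets.\<close>

lemma prob_independence_number_ge:
  fixes H :: "'a sgraph"
  assumes fin: "finite (verts H)" "finite (edges H)" and p: "0 \<le> p" "p \<le> 1"
    and E: "\<And>e. e \<in> edges H \<Longrightarrow> \<exists>x y. e = {x, y}"
    and A0: "independent_set H A0" "card A0 = N"
  shows "1 - (\<Sum>A | A \<subseteq> verts H \<and> card A = Suc N. exp (- p * real (card {e \<in> edges H. e \<subseteq> A})))
           \<le> measure_pmf.prob (random_spanning_subgraph H p) {H'. independence_number H' = N}"
proof -
  let ?G = "random_spanning_subgraph H p"
  let ?X = "{A. A \<subseteq> verts H \<and> card A = Suc N}"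
  have finX: "finite ?X" 
    by (rule finite_subset[of _ "Pow (verts H)"]) (use fin(1) in auto)
  have "1 - measure_pmf.prob ?G {H'. independence_number H' = N}
      = measure_pmf.prob ?G (UNIV - {H'. independence_number H' = N})"
    using measure_pmf.prob_compl[of "{H'. independence_number H' = N}" ?G] by simp
  also have "\<dots> \<le> measure_pmf.prob ?G (\<Union>A\<in>?X. {H'. independent_set H' A})"
  \<comment> \<open>The inclusion is checked on the support, where the sample is known to be a
    spanning subgraph of \<open>H\<close>.\<close>
  proof (rule measure_pmf.finite_measure_mono_AE)
    show "AE H' in measure_pmf ?G. H' \<in> UNIV - {H'. independence_number H' = N} \<longrightarrow>
        H' \<in> (\<Union>A\<in>?X. {H'. independent_set H' A})"
    proof (rule AE_pmfI, rule impI)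
      fix H' assume H': "H' \<in> set_pmf ?G" "H' \<in> UNIV - {H'. independence_number H' = N}"
      have sub: "verts H' = verts H" "edges H' \<subseteq> edges H"
        using set_pmf_random_spanning_subgraph[OF H'(1)] by auto
      have "independent_set H' A0" using A0(1) sub by (auto simp: independent_set_def)
      then obtain B where "independent_set H' B" "card B = Suc N"
        using independence_number_eqI[of H' A0 N] A0(2) H'(2) fin(1) sub by auto
      then show "H' \<in> (\<Union>A\<in>?X. {H'. independent_set H' A})"
        using sub by (auto simp: independent_set_def)
    qed
  qed simp
  also have "\<dots> \<le> (\<Sum>A\<in>?X. measure_pmf.prob ?G {H'. independent_set H' A})"
    using finX by (intro measure_UNION_le) auto
  also have "\<dots> \<le> (\<Sum>A\<in>?X. exp (- p * real (card {e \<in> edges H. e \<subseteq> A})))"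
    using assms by (intro sum_mono prob_independent_set_le) auto
  finally show ?thesis by simp
qed

section \<open>Edges spanned by large vertex sets\<close>

lemma verts_subset_graph: "verts (subset_graph n r s) = ksubsets n r"
  by (simp add: subset_graph_def ksubsets_def)

lemma edges_subset_graph:
  "edges (subset_graph n r s)
     = {{x, y} | x y. x \<in> ksubsets n r \<and> y \<in> ksubsets n r \<and> x \<noteq> y \<and> card (x \<inter> y) < s}"
  by (simp add: subset_graph_def ksubsets_def)

lemma finite_edges_subset_graph: "finite (edges (subset_graph n r s))"
  by (rule finite_subset[of _ "Pow (ksubsets n r)"]) (auto simp: edges_subset_graph)

lemma independent_set_star:
  assumes "card S = s"
  shows "independent_set (subset_graph n r s) (star n r S)"
proof -
  have "{x, y} \<notin> edges (subset_graph n r s)" if "x \<in> star n r S" "y \<in> star n r S" for x y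
  proof
    assume "{x, y} \<in> edges (subset_graph n r s)"
    then have "card (x \<inter> y) < s"
      by (auto simp: edges_subset_graph doubleton_eq_iff Int_commute)
    moreover have "finite x" using that ksubsets_finite by (auto simp: star_def)
    then have "card S \<le> card (x \<inter> y)" using that by (intro card_mono) (auto simp: star_def)
    ultimately show False using assms by simp
  qed
  then show ?thesis unfolding independent_set_def verts_subset_graph using star_subset by blast
qed

text \<open>With \<open>D\<close> as in the proof, a set outside the star fails to be joined to at
  most \<open>D\<close> members of the star, hence is joined to at least \<open>3 * D\<close> of the
  \<open>4 * D\<close> or more that lie in \<open>A\<close>. No edge is counted twice, as exactly
  one of its ends is in the star.\<close>

lemma card_edges_ge_large_star:
  assumes A: "A \<subseteq> ksubsets n r" and S: "S \<subseteq> {1..n}" "card S = s"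
    and s: "0 < s" "s < r" "r \<le> n"
    and large: "4 * (real r ^ 2 / real n) * real ((n - s) choose (r - s)) \<le> real (card (A \<inter> star n r S))"
  shows "real (card (A - star n r S)) * (3 * (real r ^ 2 / real n) * real ((n - s) choose (r - s)))
           \<le> real (card {e \<in> edges (subset_graph n r s). e \<subseteq> A})"
proof -
  define D where "D = real r ^ 2 / real n * real ((n - s) choose (r - s))"
  have fA: "finite A" using A by (rule finite_subset) simp
  have fS: "finite S" using S(1) by (rule finite_subset) simp
  let ?Y = "\<lambda>x. {y \<in> A \<inter> star n r S. card (x \<inter> y) < s}"
  have Y: "3 * D \<le> real (card (?Y x))" if x: "x \<in> A - star n r S" for x
  proof -
    have "x \<in> ksubsets n r" "\<not> S \<subseteq> x" using x A by (auto simp: star_def)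
    note small = card_star_inter_ge[OF fS S(2) s this]
    have "A \<inter> star n r S \<subseteq> ?Y x \<union> {y \<in> star n r S. s \<le> card (x \<inter> y)}" by auto
    then have "card (A \<inter> star n r S) \<le> card (?Y x \<union> {y \<in> star n r S. s \<le> card (x \<inter> y)})"
      using fA by (intro card_mono) auto
    also have "\<dots> \<le> card (?Y x) + card {y \<in> star n r S. s \<le> card (x \<inter> y)}" by (rule card_Un_le)
    finally have "real (card (A \<inter> star n r S))
        \<le> real (card (?Y x)) + real (card {y \<in> star n r S. s \<le> card (x \<inter> y)})"
      by (simp only: of_nat_le_iff of_nat_add[symmetric])
    then show ?thesis using small large unfolding D_def mult.assoc by linarith
  qed
  have "real (card (A - star n r S)) * (3 * D) = (\<Sum>x\<in>A - star n r S. 3 * D)" by simp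
  also have "\<dots> \<le> (\<Sum>x\<in>A - star n r S. real (card (?Y x)))" by (intro sum_mono Y)
  also have "\<dots> = real (card (SIGMA x:A - star n r S. ?Y x))" using fA by (subst card_SigmaI) auto
  also have "\<dots> \<le> real (card {e \<in> edges (subset_graph n r s). e \<subseteq> A})"
  proof -
    let ?f = "\<lambda>(x, y). {x, y}"
    have "inj_on ?f (SIGMA x:A - star n r S. ?Y x)"
      by (rule inj_onI) (auto simp: doubleton_eq_iff)
    then have "card (SIGMA x:A - star n r S. ?Y x) = card (?f ` (SIGMA x:A - star n r S. ?Y x))"
      by (simp add: card_image)
    also have "\<dots> \<le> card {e \<in> edges (subset_graph n r s). e \<subseteq> A}"
    proof (rule card_mono)
      show "finite {e \<in> edges (subset_graph n r s). e \<subseteq> A}" using finite_edges_subset_graph by simp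
      show "?f ` (SIGMA x:A - star n r S. ?Y x) \<subseteq> {e \<in> edges (subset_graph n r s). e \<subseteq> A}"
      proof
        fix e assume "e \<in> ?f ` (SIGMA x:A - star n r S. ?Y x)"
        then obtain x y where e: "e = {x, y}" "x \<in> A" "x \<notin> star n r S" "y \<in> A"
          "y \<in> star n r S" "card (x \<inter> y) < s" by auto
        then have "x \<noteq> y" "x \<in> ksubsets n r" "y \<in> ksubsets n r" using A by auto
        then show "e \<in> {e \<in> edges (subset_graph n r s). e \<subseteq> A}"
          unfolding edges_subset_graph using e by blast
      qed
    qed
    finally show ?thesis by simp
  qed
  finally show ?thesis unfolding D_def by (simp add: mult.assoc)
qed

text \<open>An edge-free \<open>B\<close> inside \<open>A\<close> is intersecting. By
  \<open>intersecting_star_or_small\<close> it has at most \<open>K\<close> members or lies in a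
  star, and in the latter case the bound on the stars of \<open>A\<close> gives \<open>K\<close>
  again. This feeds the Turan bound.\<close>

lemma card_edges_ge_small_stars:
  assumes A: "A \<subseteq> ksubsets n r" and s: "0 < s" "s < r" and n: "16 * r ^ 2 \<le> n"
    and K: "K = 4 * (real r ^ 2 / real n) * real ((n - s) choose (r - s))"
    and small: "\<And>S. S \<subseteq> {1..n} \<Longrightarrow> card S = s \<Longrightarrow> real (card (A \<inter> star n r S)) \<le> K"
  shows "real (card A) * (real (card A) - K) / (2 * K)
           \<le> real (card {e \<in> edges (subset_graph n r s). e \<subseteq> A})"
proof (rule card_edges_ge_independence_bound)
  show "card e = 2" if "e \<in> edges (subset_graph n r s)" for e
    using that by (auto simp: edges_subset_graph card_2_iff)
  have "r \<le> r ^ 2" by (simp add: power2_eq_square)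
  then have "r \<le> n" "0 < n" using n s by auto
  then show "0 < K" unfolding K using s by simp
  show "finite A" using A by (rule finite_subset) simp
  then have fA: "finite A" .
  fix B assume B: "B \<subseteq> A" "\<And>e. e \<in> edges (subset_graph n r s) \<Longrightarrow> \<not> e \<subseteq> B"
  have BV: "B \<subseteq> ksubsets n r" using A B by auto
  have "s \<le> card (x \<inter> y)" if "x \<in> B" "y \<in> B" for x y
  proof (cases "x = y")
    case True
    then show ?thesis using that BV s by (auto simp: ksubsets_def)
  next
    case False
    have "{x, y} \<notin> edges (subset_graph n r s)" using B(2)[of "{x, y}"] that by auto
    then show ?thesis using False that BV unfolding edges_subset_graph by (auto simp: not_less)
  qed
  then have "intersecting s B" by (simp add: intersecting_def)
  from intersecting_star_or_small[OF BV this s n]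
  show "real (card B) \<le> K"
  proof
    assume "real (card B) \<le> 4 * (real r ^ 2 / real n) * real ((n - s) choose (r - s))"
    then show ?thesis by (simp add: K)
  next
    assume "\<exists>S\<subseteq>{1..n}. card S = s \<and> B \<subseteq> star n r S"
    then obtain S where S: "S \<subseteq> {1..n}" "card S = s" "B \<subseteq> star n r S" by blast
    then have "card B \<le> card (A \<inter> star n r S)" using B(1) fA by (intro card_mono) auto
    then show ?thesis using small[OF S(1,2)] by simp
  qed
qed

section \<open>Union bound\<close>

text \<open>A single term of the series of \<open>exp m\<close> gives
  \<open>m ^ m \<le> exp m * fact m\<close>; it is combined with
  \<open>(M choose m) * fact m \<le> M ^ m\<close>.\<close>

lemma binomial_le_exp_power:
  assumes "0 < m"
  shows "real (M choose m) \<le> (exp 1 * real M / real m) ^ m"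
proof -
  have "(\<lambda>k. real m ^ k / fact k) sums exp (real m)"
    using exp_converges[of "real m"] by (simp add: field_simps)
  then have "(\<Sum>k\<in>{m}. real m ^ k / fact k) \<le> exp (real m)"
    by (subst sums_unique, assumption, intro sum_le_suminf) (auto simp: sums_iff)
  then have f: "real m ^ m \<le> exp 1 ^ m * fact m"
    by (simp add: divide_le_eq exp_of_nat_mult[symmetric])
  have "real ((M choose m) * fact m) \<le> real (M ^ m)"
    by (simp only: of_nat_le_iff binomial_fact_pow)
  then have "real (M choose m) * fact m \<le> real M ^ m" by simp
  then have "real (M choose m) * fact m * real m ^ m \<le> real M ^ m * (exp 1 ^ m * fact m)"
    using f by (intro mult_mono) auto
  then have "real (M choose m) * real m ^ m * fact m \<le> (exp 1 ^ m * real M ^ m) * fact m"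
    by (simp only: mult_ac)
  then have "real (M choose m) * real m ^ m \<le> exp 1 ^ m * real M ^ m"
    by (rule mult_right_le_imp_le) simp
  then show ?thesis using assms by (simp add: power_mult_distrib power_divide pos_le_divide_eq)
qed

text \<open>Each step costs a factor \<open>(n - i) / (r - i)\<close> with \<open>i < s\<close>, at
  most \<open>n / (r - s)\<close>. For \<open>j = s\<close> this compares the number of all vertices
  with the size of a star.\<close>

lemma binomial_ascend_le:
  assumes "s < r" "r \<le> n" "j \<le> s"
  shows "real (n choose r) \<le> (real n / real (r - s)) ^ j * real ((n - j) choose (r - j))"
  using assms(3)
proof (induction j)
  case 0 then show ?case by simp
next
  case (Suc j)
  define m k where "m = n - Suc j" and "k = r - Suc j"
  have mk: "n - j = Suc m" "r - j = Suc k" "r - s \<le> Suc k" "Suc m \<le> n"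
    using Suc.prems assms by (auto simp: m_def k_def)
  have "Suc k * (Suc m choose Suc k) = Suc m * (m choose k)"
    using binomial_absorption[of k "Suc m"] by simp
  then have "real (Suc k) * real (Suc m choose Suc k) = real (Suc m) * real (m choose k)"
    by (metis of_nat_mult)
  then have "real (Suc m choose Suc k) = real (Suc m) / real (Suc k) * real (m choose k)"
    by (simp add: field_simps del: binomial_Suc_Suc of_nat_Suc)
  also have "\<dots> \<le> real n / real (r - s) * real (m choose k)"
    using mk assms by (intro mult_right_mono frac_le) auto
  finally have step: "real (Suc m choose Suc k) \<le> real n / real (r - s) * real (m choose k)" .
  have "real (n choose r) \<le> (real n / real (r - s)) ^ j * real (Suc m choose Suc k)"
    using Suc.IH Suc.prems mk by simp
  also have "\<dots> \<le> (real n / real (r - s)) ^ j * (real n / real (r - s) * real (m choose k))"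
    by (intro mult_left_mono step) auto
  finally show ?case by (simp add: m_def k_def mult_ac)
qed

text \<open>\<open>A\<close> is recovered from its part outside the star and the part of the star it
  misses. Since \<open>A\<close> has one element more than the star, \<open>k\<close> elements
  outside mean exactly \<open>k - 1\<close> missing ones. Each single set is chosen in at most
  \<open>2 ^ n\<close> ways.\<close>

lemma card_large_star_families_le:
  assumes S: "S \<subseteq> {1..n}" "card S = s" "s \<le> r" and k: "0 < k"
  shows "card {A. A \<subseteq> ksubsets n r \<and> card A = Suc ((n - s) choose (r - s)) \<and> card (A - star n r S) = k}
           \<le> (2 ^ n) ^ k * (2 ^ n) ^ k"
proof -
  define N where "N = (n - s) choose (r - s)"
  let ?X = "{A. A \<subseteq> ksubsets n r \<and> card A = Suc N \<and> card (A - star n r S) = k}"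
  let ?P = "{E. E \<subseteq> ksubsets n r \<and> card E = k} \<times> {D. D \<subseteq> star n r S \<and> card D = k - 1}"
  let ?f = "\<lambda>A. (A - star n r S, star n r S - A)"
  have pow: "m choose l \<le> m ^ l" for m l :: nat
    by (cases "l \<le> m") (simp_all add: binomial_le_pow binomial_eq_0)
  have cs: "card (star n r S) = N" using S card_star unfolding N_def by simp
  have N2: "N \<le> 2 ^ n"
    unfolding N_def using binomial_le_pow2[of "n - s" "r - s"] by (meson diff_le_self le_trans one_le_numeral power_increasing)
  have fP: "finite ?P" 
    by (intro finite_cartesian_product finite_subset[of "{E. E \<subseteq> ksubsets n r \<and> card E = k}" "Pow (ksubsets n r)"]
          finite_subset[of "{D. D \<subseteq> star n r S \<and> card D = k - 1}" "Pow (star n r S)"]) auto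
  have "inj_on ?f ?X"
  proof (rule inj_onI)
    fix A B assume "?f A = ?f B"
    then show "A = B" by blast
  qed
  moreover have "?f ` ?X \<subseteq> ?P"
  proof
    fix z assume "z \<in> ?f ` ?X"
    then obtain A where A: "A \<subseteq> ksubsets n r" "card A = Suc N" "card (A - star n r S) = k" "z = ?f A"
      by auto
    have fA: "finite A" using A(1) by (rule finite_subset) simp
    have "card A = card (A - star n r S) + card (A \<inter> star n r S)"
      using card_Int_Diff[OF fA, of "star n r S"] by simp
    moreover have "card (star n r S - A) + card (A \<inter> star n r S) = N"
      using card_Diff_subset_Int[of "star n r S" A] card_mono[of "star n r S" "A \<inter> star n r S"] cs
      by (simp add: Int_commute)
    ultimately have "card (star n r S - A) = k - 1" using A by linarith
    then show "z \<in> ?P" using A by auto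
  qed
  ultimately have "card ?X \<le> card ?P" using fP by (rule card_inj_on_le)
  also have "\<dots> = ((n choose r) choose k) * (N choose (k - 1))"
    by (simp add: card_cartesian_product n_subsets card_ksubsets cs)
  also have "\<dots> \<le> (2 ^ n) ^ k * (2 ^ n) ^ k"
  proof (rule mult_le_mono)
    have "(n choose r) choose k \<le> (n choose r) ^ k" by (rule pow)
    also have "\<dots> \<le> (2 ^ n) ^ k" by (intro power_mono binomial_le_pow2) simp
    finally show "(n choose r) choose k \<le> (2 ^ n) ^ k" .
    have "N choose (k - 1) \<le> N ^ (k - 1)" by (rule pow)
    also have "\<dots> \<le> (2 ^ n) ^ (k - 1)" by (intro power_mono N2) simp
    also have "\<dots> \<le> (2 ^ n) ^ k" by (intro power_increasing) auto
    finally show "N choose (k - 1) \<le> (2 ^ n) ^ k" .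
  qed
  finally show ?thesis unfolding N_def .
qed

text \<open>With \<open>m = Suc N\<close>, the Turan bound and the lower bound on \<open>p\<close>
  make each term at most \<open>exp (- 3/2 * m * s * L)\<close>, while there are at most
  \<open>exp (m * (1 + s * (1 + L)))\<close> sets \<open>A\<close>. The surplus
  \<open>m * s * L / 2\<close> beats the lower-order terms because
  \<open>L \<ge> 10\<close>.\<close>

lemma sum_small_stars_le:
  fixes p :: real and n r s :: nat
  defines "N \<equiv> (n - s) choose (r - s)" and "\<delta> \<equiv> real r ^ 2 / real n"
    and "L \<equiv> ln (real n / real r)"
  assumes s: "0 < s" "2 * s \<le> r" and n: "16 * r ^ 2 \<le> n" and L: "10 \<le> L"
    and p: "16 * real s * \<delta> * L \<le> p"
    and X: "\<And>A. A \<in> X \<Longrightarrow> A \<subseteq> ksubsets n r \<and> card A = Suc N \<and>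
          (\<forall>S. S \<subseteq> {1..n} \<longrightarrow> card S = s \<longrightarrow> real (card (A \<inter> star n r S)) \<le> 4 * \<delta> * real N)"
  shows "(\<Sum>A\<in>X. exp (- p * real (card {e \<in> edges (subset_graph n r s). e \<subseteq> A}))) \<le> exp (- real s)"
proof -
  define m where "m = real (Suc N)"
  have r0: "0 < r" "s < r" using s by auto
  have "r \<le> r ^ 2" by (simp add: power2_eq_square)
  then have rn: "r \<le> n" "0 < n" using n r0 by auto
  have N0: "0 < N" unfolding N_def using rn r0 by simp
  have m: "real N \<le> m" "1 \<le> m" "0 < m" by (auto simp: m_def)
  have \<delta>: "0 < \<delta>" "\<delta> \<le> 1/16"
    unfolding \<delta>_def using of_nat_mono[OF n, where 'a = real] r0 rn by (simp_all add: divide_le_eq)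
  have p0: "0 \<le> p" using p \<delta> L s by (smt (verit) mult_nonneg_nonneg of_nat_0_le_iff)
  have each: "exp (- p * real (card {e \<in> edges (subset_graph n r s). e \<subseteq> A}))
      \<le> exp (- (3/2 * m * real s * L))" if A: "A \<in> X" for A
  proof -
    define K where "K = 4 * \<delta> * real N"
    have K0: "0 < K" unfolding K_def using \<delta> N0 by simp
    have "m * (m - K) / (2 * K) \<le> real (card {e \<in> edges (subset_graph n r s). e \<subseteq> A})"
      using card_edges_ge_small_stars[of A n r s K] X[OF A] s r0 n
      unfolding m_def K_def \<delta>_def N_def by auto
    \<comment> \<open>From \<open>\<delta> \<le> 1/16\<close> follows \<open>K \<le> m / 4\<close>,
      so \<open>m - K\<close> is at least \<open>3/4 * m\<close>; dividing by
      \<open>2 * K = 8 * \<delta> * N\<close> and using \<open>N \<le> m\<close> gives 3/32.\<close>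
    moreover have "3/32 * m / \<delta> \<le> m * (m - K) / (2 * K)"
    proof -
      have "\<delta> * real N \<le> 1/16 * m" using \<delta> m by (intro mult_mono) auto
      then have "3/4 * m \<le> m - K" unfolding K_def by linarith
      then have "m * (3/4 * m) / (2 * K) \<le> m * (m - K) / (2 * K)"
        using K0 m by (intro divide_right_mono mult_left_mono) auto
      moreover have "3/32 * m / \<delta> \<le> m * (3/4 * m) / (2 * K)"
      proof -
        have "3/32 * m / \<delta> = m * (3/4 * real N) / (2 * K)"
          unfolding K_def using N0 \<delta> by (simp add: field_simps)
        also have "\<dots> \<le> m * (3/4 * m) / (2 * K)"
          using K0 m by (intro divide_right_mono mult_left_mono) auto
        finally show ?thesis .
      qed
      ultimately show ?thesis by linarith
    qed
    ultimately have "3/32 * m / \<delta> \<le> real (card {e \<in> edges (subset_graph n r s). e \<subseteq> A})"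
      by linarith
    then have "(16 * real s * \<delta> * L) * (3/32 * m / \<delta>)
        \<le> p * real (card {e \<in> edges (subset_graph n r s). e \<subseteq> A})"
      using p p0 \<delta> m by (intro mult_mono) auto
    also have "(16 * real s * \<delta> * L) * (3/32 * m / \<delta>) = 3/2 * m * real s * L"
      using \<delta> by (simp add: field_simps)
    finally show ?thesis by simp
  qed
  have "X \<subseteq> {A. A \<subseteq> ksubsets n r \<and> card A = Suc N}" using X by auto
  moreover have "finite {A. A \<subseteq> ksubsets n r \<and> card A = Suc N}"
    by (rule finite_subset[of _ "Pow (ksubsets n r)"]) auto
  ultimately have "card X \<le> card {A. A \<subseteq> ksubsets n r \<and> card A = Suc N}" by (intro card_mono)
  also have "\<dots> = (n choose r) choose Suc N" by (simp add: n_subsets card_ksubsets)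
  finally have "real (card X) \<le> real ((n choose r) choose Suc N)" by simp
  also have "\<dots> \<le> (exp 1 * real (n choose r) / m) ^ Suc N"
    unfolding m_def by (rule binomial_le_exp_power) simp
  also have "\<dots> \<le> (exp 1 * (2 * (real n / real r)) ^ s) ^ Suc N"
  proof (rule power_mono)
    have "real (n choose r) \<le> (real n / real (r - s)) ^ s * real N"
      unfolding N_def using binomial_ascend_le[of s r n s] r0 rn by simp
    also have "\<dots> \<le> (2 * (real n / real r)) ^ s * m"
    proof (intro mult_mono power_mono)
      have "real n / real (r - s) \<le> real n / (real r / 2)"
        using s r0 by (intro divide_left_mono) auto
      then show "real n / real (r - s) \<le> 2 * (real n / real r)" by (simp add: mult.commute)
    qed (use m in auto)
    finally have "real (n choose r) / m \<le> (2 * (real n / real r)) ^ s"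
      using m by (simp add: divide_le_eq)
    then have "exp 1 * (real (n choose r) / m) \<le> exp 1 * (2 * (real n / real r)) ^ s"
      by (intro mult_left_mono) auto
    then show "exp 1 * real (n choose r) / m \<le> exp 1 * (2 * (real n / real r)) ^ s" by simp
  qed (use m in auto)
  \<comment> \<open>The factor 2, which came from \<open>r - s \<ge> r / 2\<close>, is absorbed into
    \<open>exp 1\<close>.\<close>
  also have "\<dots> \<le> exp (1 + real s * (1 + L)) ^ Suc N"
  proof (rule power_mono)
    have "2 * (real n / real r) \<le> exp 1 * exp L"
      unfolding L_def using rn r0 exp_ge_add_one_self[of 1] by (intro mult_mono) auto
    then have "(2 * (real n / real r)) ^ s \<le> exp (1 + L) ^ s"
      using rn r0 by (intro power_mono) (auto simp: exp_add)
    then show "exp 1 * (2 * (real n / real r)) ^ s \<le> exp (1 + real s * (1 + L))"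
      by (simp add: exp_add exp_of_nat_mult)
  qed (use rn r0 in auto)
  also have "\<dots> = exp (m * (1 + real s * (1 + L)))"
    unfolding m_def by (simp only: exp_of_nat_mult)
  finally have cX: "real (card X) \<le> exp (m * (1 + real s * (1 + L)))" .
  have "(\<Sum>A\<in>X. exp (- p * real (card {e \<in> edges (subset_graph n r s). e \<subseteq> A})))
      \<le> real (card X) * exp (- (3/2 * m * real s * L))"
    using sum_mono[OF each] by simp
  also have "\<dots> \<le> exp (m * (1 + real s * (1 + L))) * exp (- (3/2 * m * real s * L))"
    by (intro mult_right_mono cX) auto
  also have "\<dots> = exp (m * (1 + real s - 1/2 * (real s * L)))"
    unfolding exp_add[symmetric] by (simp add: algebra_simps)
  also have "\<dots> \<le> exp (- real s)"
  proof -
    have "real s * 10 \<le> real s * L" using L by (intro mult_left_mono) auto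
    moreover have "1 \<le> real s" using s by simp
    ultimately have "1 + real s - 1/2 * (real s * L) \<le> - real s" by linarith
    then have "m * (1 + real s - 1/2 * (real s * L)) \<le> m * (- real s)"
      using m by (intro mult_left_mono) auto
    also have "\<dots> \<le> 1 * (- real s)" using m by (intro mult_right_mono_neg) auto
    finally show ?thesis by simp
  qed
  finally show ?thesis .
qed

text \<open>The binomial coefficient is at least a power of \<open>n / r\<close> with exponent
  \<open>r - s \<ge> 8\<close>, and \<open>n / r\<close> is at least the square root of
  \<open>n\<close>. This lets \<open>N\<close> outweigh the small factor \<open>\<delta> ^ 2\<close>
  in the large-star case.\<close>

lemma binomial_ge_power4:
  assumes "16 \<le> r" "2 * s \<le> r" "r ^ 2 \<le> n"
  shows "real n ^ 4 \<le> real ((n - s) choose (r - s))"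
proof -
  have "r \<le> r ^ 2" by (simp add: power2_eq_square)
  then have rn: "r \<le> n" "0 < n" "0 < r" "s < r" using assms by auto
  have nr: "real n / real r \<le> real (n - s) / real (r - s)"
  proof -
    have "real s * real r \<le> real s * real n" using rn by (intro mult_left_mono) auto
    then have "real n * (real r - real s) \<le> (real n - real s) * real r"
      by (simp add: algebra_simps)
    then show ?thesis using rn by (simp add: divide_le_eq le_divide_eq of_nat_diff field_simps)
  qed
  have sq: "real n \<le> (real n / real r) ^ 2"
  proof -
    have "real r ^ 2 \<le> real n" using of_nat_mono[OF assms(3), where 'a = real] by simp
    then have "real n * real r ^ 2 \<le> real n * real n" by (intro mult_left_mono) auto
    then show ?thesis using rn by (simp add: power_divide le_divide_eq power2_eq_square)
  qed
  have "real n ^ 4 \<le> ((real n / real r) ^ 2) ^ 4" by (intro power_mono sq) auto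
  also have "\<dots> = (real n / real r) ^ 8" by (simp flip: power_mult)
  also have "\<dots> \<le> (real n / real r) ^ (r - s)"
    using assms rn by (intro power_increasing) auto
  also have "\<dots> \<le> (real (n - s) / real (r - s)) ^ (r - s)"
    by (intro power_mono nr) auto
  also have "\<dots> \<le> real ((n - s) choose (r - s))"
    using rn by (intro binomial_ge_n_over_k_pow_k) auto
  finally show ?thesis .
qed

text \<open>The sets \<open>A\<close> are grouped by a large star and the number \<open>k\<close> of
  members outside it. Since \<open>p \<ge> 160 * \<delta>\<close>,
  \<open>\<delta> \<ge> 1 / n\<close> and \<open>N \<ge> n ^ 4\<close>, the
  \<open>3 * \<delta> * N * k\<close> edges give the exponent \<open>- 480 * n ^ 2 * k\<close>,
  against at most \<open>exp (2 * n * k)\<close> sets in a group and \<open>exp (3 * n)\<close>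
  groups.\<close>

lemma sum_large_stars_le:
  fixes p :: real and n r s :: nat
  defines "N \<equiv> (n - s) choose (r - s)" and "\<delta> \<equiv> real r ^ 2 / real n"
  assumes s: "0 < s" "2 * s \<le> r" and r: "16 \<le> r" and n: "16 * r ^ 2 \<le> n"
    and p: "160 * \<delta> \<le> p" and finX: "finite X"
    and X: "\<And>A. A \<in> X \<Longrightarrow> A \<subseteq> ksubsets n r \<and> card A = Suc N \<and>
          (\<exists>S. S \<subseteq> {1..n} \<and> card S = s \<and> 4 * \<delta> * real N \<le> real (card (A \<inter> star n r S)))"
  shows "(\<Sum>A\<in>X. exp (- p * real (card {e \<in> edges (subset_graph n r s). e \<subseteq> A}))) \<le> exp (- real n)"
proof -
  let ?w = "\<lambda>A. exp (- p * real (card {e \<in> edges (subset_graph n r s). e \<subseteq> A}))"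
  have r0: "0 < r" "s < r" using s r by auto
  have "r \<le> r ^ 2" by (simp add: power2_eq_square)
  then have rn: "r \<le> n" "0 < n" using n r0 by auto
  have \<delta>: "1 / real n \<le> \<delta>" unfolding \<delta>_def using r0 by (intro divide_right_mono) auto
  then have \<delta>0: "0 \<le> \<delta>" by (rule order_trans[rotated]) simp
  have p0: "0 \<le> p" using p \<delta>0 by linarith
  have N4: "real n ^ 4 \<le> real N" unfolding N_def using s r n by (intro binomial_ge_power4) auto
  have rate: "480 * real n ^ 2 \<le> p * (3 * \<delta> * real N)"
  proof -
    have "480 * real n ^ 2 = (160 * (1 / real n)) * (3 * (1 / real n) * real n ^ 4)"
      using rn by (simp add: field_simps power2_eq_square power4_eq_xxxx)
    also have "\<dots> \<le> (160 * \<delta>) * (3 * \<delta> * real N)"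
      using \<delta> \<delta>0 N4 by (intro mult_mono) auto
    also have "\<dots> \<le> p * (3 * \<delta> * real N)" using p \<delta>0 by (intro mult_right_mono) auto
    finally show ?thesis .
  qed
  \<comment> \<open>Fixing one large star for each \<open>A\<close> puts \<open>A\<close> into
    exactly one group.\<close>
  obtain \<sigma> where \<sigma>: "\<And>A. A \<in> X \<Longrightarrow> \<sigma> A \<subseteq> {1..n} \<and> card (\<sigma> A) = s \<and>
      4 * \<delta> * real N \<le> real (card (A \<inter> star n r (\<sigma> A)))"
    using X by metis
  define g where "g = (\<lambda>A. (\<sigma> A, card (A - star n r (\<sigma> A))))"
  \<comment> \<open>The count \<open>k\<close> starts at 1: \<open>A\<close> has
    \<open>Suc N\<close> members and the star only \<open>N\<close>. This makes every group's bound
    decay.\<close>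
  let ?T = "{S. S \<subseteq> {1..n} \<and> card S = s} \<times> {1..Suc N}"
  have finT: "finite ?T" by (intro finite_cartesian_product) auto
  have gT: "g ` X \<subseteq> ?T"
  proof
    fix z assume "z \<in> g ` X"
    then obtain A where A: "A \<in> X" "z = g A" by blast
    have fA: "finite A" using X[OF A(1)] finite_subset[OF _ finite_ksubsets] by blast
    have "card (star n r (\<sigma> A)) = N"
      using card_star[of "\<sigma> A" n r] \<sigma>[OF A(1)] r0 unfolding N_def by simp
    then have "\<not> A \<subseteq> star n r (\<sigma> A)"
      using card_mono[of "star n r (\<sigma> A)" A] X[OF A(1)] by auto
    then have "A - star n r (\<sigma> A) \<noteq> {}" by blast
    then have "0 < card (A - star n r (\<sigma> A))" using fA by (simp add: card_gt_0_iff)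
    moreover have "card (A - star n r (\<sigma> A)) \<le> Suc N"
      using card_mono[of A "A - star n r (\<sigma> A)"] fA X[OF A(1)] by auto
    ultimately show "z \<in> ?T" using \<sigma>[OF A(1)] unfolding A(2) g_def by auto
  qed
  have two: "(2::real) ^ n \<le> exp (real n)"
  proof -
    have "(2::real) ^ n \<le> exp 1 ^ n" using exp_ge_add_one_self[of "1::real"] by (intro power_mono) auto
    then show ?thesis by (simp add: exp_of_nat_mult[symmetric])
  qed
  have fiber: "(\<Sum>A | A \<in> X \<and> g A = t. ?w A) \<le> exp (- 478 * real n ^ 2)" if t: "t \<in> ?T" for t
  proof -
    obtain S k where t': "t = (S, k)" "S \<subseteq> {1..n}" "card S = s" "0 < k" using t by auto
    let ?F = "{A \<in> X. g A = t}"
    have w: "?w A \<le> exp (- (real k * (480 * real n ^ 2)))" if A: "A \<in> ?F" for A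
    proof -
      have SA: "\<sigma> A = S" "card (A - star n r S) = k" using A t' by (auto simp: g_def)
      have "real k * (3 * \<delta> * real N) \<le> real (card {e \<in> edges (subset_graph n r s). e \<subseteq> A})"
        using card_edges_ge_large_star[of A n r S s] X[of A] \<sigma>[of A] A SA s r0 rn t'
        unfolding N_def \<delta>_def by auto
      then have "p * (real k * (3 * \<delta> * real N))
          \<le> p * real (card {e \<in> edges (subset_graph n r s). e \<subseteq> A})"
        using p0 by (rule mult_left_mono)
      moreover have "real k * (480 * real n ^ 2) \<le> real k * (p * (3 * \<delta> * real N))"
        using rate by (intro mult_left_mono) auto
      ultimately show ?thesis by (simp add: mult_ac)
    qed
    have "?F \<subseteq> {A. A \<subseteq> ksubsets n r \<and> card A = Suc N \<and> card (A - star n r S) = k}"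
      using X t' by (auto simp: g_def)
    moreover have "finite {A. A \<subseteq> ksubsets n r \<and> card A = Suc N \<and> card (A - star n r S) = k}"
      by (rule finite_subset[of _ "Pow (ksubsets n r)"]) auto
    ultimately have "card ?F \<le> card {A. A \<subseteq> ksubsets n r \<and> card A = Suc N \<and> card (A - star n r S) = k}"
      by (intro card_mono)
    also have "\<dots> \<le> (2 ^ n) ^ k * (2 ^ n) ^ k"
      unfolding N_def using card_large_star_families_le[OF t'(2,3) _ t'(4)] r0 by auto
    finally have "real (card ?F) \<le> real ((2 ^ n) ^ k * (2 ^ n) ^ k)" by (simp only: of_nat_le_iff)
    also have "\<dots> = (2 ^ n) ^ k * (2 ^ n) ^ k" by simp
    also have "\<dots> \<le> exp (real n) ^ k * exp (real n) ^ k"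
      using two by (intro mult_mono power_mono) auto
    also have "\<dots> = exp (real k * (2 * real n))"
      by (simp add: exp_of_nat_mult[symmetric] exp_add[symmetric] algebra_simps)
    finally have cF: "real (card ?F) \<le> exp (real k * (2 * real n))" .
    have "(\<Sum>A\<in>?F. ?w A) \<le> real (card ?F) * exp (- (real k * (480 * real n ^ 2)))"
      using sum_mono[OF w, of ?F "\<lambda>A. A"] by simp
    also have "\<dots> \<le> exp (real k * (2 * real n)) * exp (- (real k * (480 * real n ^ 2)))"
      by (intro mult_right_mono cF) auto
    also have "\<dots> = exp (real k * (2 * real n - 480 * real n ^ 2))"
      unfolding exp_add[symmetric] by (simp add: algebra_simps)
    also have "\<dots> \<le> exp (- 478 * real n ^ 2)"
    proof -
      have nn: "real n \<le> real n ^ 2" using rn by (simp add: power2_eq_square)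
      have "real k * (2 * real n - 480 * real n ^ 2) \<le> real k * (- 478 * real n ^ 2)"
        using nn by (intro mult_left_mono) auto
      also have "\<dots> \<le> 1 * (- 478 * real n ^ 2)"
        using t'(4) by (intro mult_right_mono_neg) auto
      finally show ?thesis by simp
    qed
    finally show ?thesis by simp
  qed
  have "(\<Sum>A\<in>X. ?w A) = (\<Sum>t\<in>?T. \<Sum>A | A \<in> X \<and> g A = t. ?w A)"
    using sum.group[OF finX finT gT, of ?w] by simp
  also have "\<dots> \<le> (\<Sum>t\<in>?T. exp (- 478 * real n ^ 2))" by (intro sum_mono fiber)
  also have "\<dots> = real ((n choose s) * Suc N) * exp (- 478 * real n ^ 2)"
    by (simp add: card_cartesian_product n_subsets)
  also have "\<dots> \<le> exp (3 * real n) * exp (- 478 * real n ^ 2)"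
  proof (intro mult_right_mono)
    have "real (n choose s) \<le> 2 ^ n" using of_nat_mono[OF binomial_le_pow2[of n s], where 'a = real] by simp
    then have a: "real (n choose s) \<le> exp (real n)" using two by linarith
    have "real N \<le> 2 ^ (n - s)"
      unfolding N_def using of_nat_mono[OF binomial_le_pow2[of "n - s" "r - s"], where 'a = real] by simp
    also have "\<dots> \<le> 2 ^ n" by (intro power_increasing) auto
    finally have "real (Suc N) \<le> exp (real n) + exp (real n)"
      using two one_le_exp_iff[of "real n"] unfolding of_nat_Suc by linarith
    also have "\<dots> \<le> exp (real n) * exp (real n)"
    proof -
      have "1 \<le> real n" using rn by simp
      then have "2 \<le> exp (real n)" using exp_ge_add_one_self[of "real n"] by linarith
      then have "2 * exp (real n) \<le> exp (real n) * exp (real n)" by (intro mult_right_mono) auto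
      then show ?thesis by simp
    qed
    finally have b: "real (Suc N) \<le> exp (real n) * exp (real n)" .
    have "real ((n choose s) * Suc N) = real (n choose s) * real (Suc N)" by (rule of_nat_mult)
    also have "\<dots> \<le> exp (real n) * (exp (real n) * exp (real n))"
      by (rule mult_mono[OF a b]) auto
    also have "\<dots> = exp (3 * real n)" by (simp add: exp_add[symmetric])
    finally show "real ((n choose s) * Suc N) \<le> exp (3 * real n)" .
  qed simp
  also have "\<dots> = exp (3 * real n - 478 * real n ^ 2)" by (simp add: exp_add[symmetric])
  also have "\<dots> \<le> exp (- real n)"
  proof -
    have "real n \<le> real n ^ 2" using rn by (simp add: power2_eq_square)
    then have "3 * real n - 478 * real n ^ 2 \<le> - real n" using of_nat_0_le_iff[of n] by linarith
    then show ?thesis by simp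
  qed
  finally show ?thesis .
qed

section \<open>Explicit probability bound and passage to the limit\<close>

lemma prob_independence_number_subset_graph:
  fixes p :: real and n r s :: nat
  assumes s: "0 < s" "2 * s \<le> r" and r: "16 \<le> r" and n: "16 * r ^ 2 \<le> n"
    and L: "10 \<le> ln (real n / real r)"
    and p: "16 * real s * real r ^ 2 * ln (real n / real r) / real n \<le> p" "p \<le> 1"
  shows "1 - (exp (- real s) + exp (- real n))
    \<le> measure_pmf.prob (random_subset_graph n r s p)
         {H. independence_number H = (n - s) choose (r - s)}"
proof -
  define N where "N = (n - s) choose (r - s)"
  define \<delta> where "\<delta> = real r ^ 2 / real n"
  define L where "L = ln (real n / real r)"
  have r0: "s < r" using s by auto
  have "r \<le> r ^ 2" by (simp add: power2_eq_square)
  then have rn: "r \<le> n" using n by auto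
  have p1: "16 * real s * \<delta> * L \<le> p" using p(1) unfolding \<delta>_def L_def by simp
  have \<delta>0: "0 \<le> \<delta>" by (simp add: \<delta>_def)
  \<comment> \<open>The large-star case needs only \<open>160 * \<delta> \<le> p\<close>, which
    follows from \<open>s \<ge> 1\<close> and \<open>L \<ge> 10\<close>; the full strength of the
    bound on \<open>p\<close> is spent in the small-star case.\<close>
  have "1 * 10 \<le> real s * L" using s L unfolding L_def by (intro mult_mono) auto
  then have "16 * \<delta> * 10 \<le> 16 * \<delta> * (real s * L)" using \<delta>0 by (intro mult_left_mono) auto
  then have p2: "160 * \<delta> \<le> p" using p1 by (simp add: mult_ac)
  then have p0: "0 \<le> p" using \<delta>0 by linarith
  let ?G = "subset_graph n r s"
  let ?w = "\<lambda>A. exp (- p * real (card {e \<in> edges ?G. e \<subseteq> A}))"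
  let ?X = "{A. A \<subseteq> verts ?G \<and> card A = Suc N}"
  let ?large = "\<lambda>A. \<exists>S. S \<subseteq> {1..n} \<and> card S = s \<and> 4 * \<delta> * real N \<le> real (card (A \<inter> star n r S))"
  have finX: "finite ?X"
    by (rule finite_subset[of _ "Pow (ksubsets n r)"]) (auto simp: verts_subset_graph)
  have split: "?X = {A \<in> ?X. ?large A} \<union> {A \<in> ?X. \<not> ?large A}" by blast
  have "(\<Sum>A\<in>?X. ?w A) = (\<Sum>A\<in>{A \<in> ?X. ?large A}. ?w A) + (\<Sum>A\<in>{A \<in> ?X. \<not> ?large A}. ?w A)"
    by (subst split, rule sum.union_disjoint)
      (use finite_subset[OF _ finX] in \<open>auto simp: subset_eq\<close>)
  moreover have "(\<Sum>A\<in>{A \<in> ?X. ?large A}. ?w A) \<le> exp (- real n)"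
    using finX p2 unfolding \<delta>_def N_def verts_subset_graph
    by (intro sum_large_stars_le s r n) auto
  moreover have "(\<Sum>A\<in>{A \<in> ?X. \<not> ?large A}. ?w A) \<le> exp (- real s)"
    using p1 L unfolding \<delta>_def N_def L_def verts_subset_graph
    by (intro sum_small_stars_le s n) (auto simp: not_le intro: less_imp_le)
  ultimately have total: "(\<Sum>A\<in>?X. ?w A) \<le> exp (- real s) + exp (- real n)" by linarith
  have S: "{1..s} \<subseteq> {1..n}" "card {1..s} = s" using r0 rn by auto
  have "card (star n r {1..s}) = N"
    using card_star[OF S(1)] S(2) r0 unfolding N_def by simp
  moreover have "\<exists>x y. e = {x, y}" if "e \<in> edges ?G" for e
    using that by (auto simp: edges_subset_graph)
  ultimately have "1 - (\<Sum>A\<in>?X. ?w A)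
      \<le> measure_pmf.prob (random_spanning_subgraph ?G p) {H'. independence_number H' = N}"
    using p0 p(2) independent_set_star[OF S(2), of n r]
    by (intro prob_independence_number_ge[where ?A0.0 = "star n r {1..s}"] finite_edges_subset_graph)
       (auto simp: verts_subset_graph)
  then show ?thesis using total unfolding random_subset_graph_def N_def by linarith
qed

theorem theorem1:
  fixes r s :: "nat \<Rightarrow> nat" and p :: "nat \<Rightarrow> real"
  assumes "\<forall>\<^sub>F n in sequentially. 0 < s n \<and> s n < r n \<and> r n < n"
    and "filterlim r at_top sequentially"
    and "filterlim s at_top sequentially"
    and "(\<lambda>n. real (s n)) \<in> o[sequentially](\<lambda>n. real (r n))"
    and "(\<lambda>n. real (r n) ^ 2) \<in> o[sequentially](\<lambda>n. real n)"
    and "\<forall>\<^sub>F n in sequentially. 0 \<le> p n \<and> p n \<le> 1"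
    and "\<forall>\<^sub>F n in sequentially.
           p n \<ge> 16 * real (s n) * real (r n) ^ 2 * ln (real n / real (r n)) / real n"
  shows "(\<lambda>n. measure_pmf.prob (random_subset_graph n (r n) (s n) (p n))
            {H. independence_number H = (n - s n) choose (r n - s n)}) \<longlonglongrightarrow> 1"
proof (rule tendsto_sandwich)
  let ?P = "\<lambda>n. measure_pmf.prob (random_subset_graph n (r n) (s n) (p n))
            {H. independence_number H = (n - s n) choose (r n - s n)}"
  \<comment> \<open>Once \<open>r n \<ge> exp 10\<close>, the bound
    \<open>16 * r ^ 2 \<le> n\<close> gives \<open>n / r \<ge> r \<ge> exp 10\<close>, so the
    logarithm is at least 10; 16 is the bound on \<open>r\<close> that the finite estimate asks for.
    The constants 1/2 and 1/16 drawn from the little-o assumptions yield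
    \<open>2 * s \<le> r\<close> and \<open>16 * r ^ 2 \<le> n\<close>.\<close>
  define R where "R = max 16 (nat \<lceil>exp 10 :: real\<rceil>)"
  have "\<forall>\<^sub>F n in sequentially. R \<le> r n"
    using assms(2) by (auto simp: filterlim_at_top)
  moreover have "\<forall>\<^sub>F n in sequentially. norm (real (s n)) \<le> 1/2 * norm (real (r n))"
    using landau_o.smallD[OF assms(4), of "1/2"] by simp
  moreover have "\<forall>\<^sub>F n in sequentially. norm (real (r n) ^ 2) \<le> 1/16 * norm (real n)"
    using landau_o.smallD[OF assms(5), of "1/16"] by simp
  ultimately show "\<forall>\<^sub>F n in sequentially. 1 - (exp (- real (s n)) + exp (- real n)) \<le> ?P n"
    using assms(1,6,7)
  proof eventually_elim
    case (elim n)
    have r: "16 \<le> r n" "exp 10 \<le> real (r n)" using elim(1) unfolding R_def by linarith+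
    have s2: "2 * s n \<le> r n" using elim(2) by simp
    have sq: "16 * real (r n) ^ 2 \<le> real n" using elim(3) by simp
    then have "real (16 * r n ^ 2) \<le> real n" by simp
    then have sqn: "16 * r n ^ 2 \<le> n" by (simp only: of_nat_le_iff)
    have "exp 10 * real (r n) \<le> real (r n) * real (r n)" using r by (intro mult_right_mono) auto
    also have "\<dots> \<le> real n" using sq by (simp add: power2_eq_square)
    finally have "exp 10 \<le> real n / real (r n)" using r(1) by (simp add: le_divide_eq)
    moreover then have "0 < real n / real (r n)" by (rule less_le_trans[rotated]) simp
    ultimately have "10 \<le> ln (real n / real (r n))" by (simp add: ln_ge_iff)
    then show ?case using elim r s2 sqn by (intro prob_independence_number_subset_graph) auto
  qed
  show "\<forall>\<^sub>F n in sequentially. ?P n \<le> 1" by simp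
  have "(\<lambda>n. exp (- real n)) \<longlonglongrightarrow> 0" 
    by (rule filterlim_compose[OF exp_at_bot])
       (simp add: filterlim_uminus_at_bot filterlim_real_sequentially)
  moreover from filterlim_compose[OF this assms(3)] have "(\<lambda>n. exp (- real (s n))) \<longlonglongrightarrow> 0" .
  ultimately have "(\<lambda>n. 1 - (exp (- real (s n)) + exp (- real n))) \<longlonglongrightarrow> 1 - (0 + 0)"
    by (intro tendsto_intros)
  then show "(\<lambda>n. 1 - (exp (- real (s n)) + exp (- real n))) \<longlonglongrightarrow> 1" by simp
qed simp

end
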